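(* Let $(M,g)$ be a connected K\"ahler manifold of real dimension $2m$. Set $$C(m)=\begin{cases}3m\,\dfrac{m+1}{m+2} & \text{if } m \text{ is even},\\[2mm] 3m\,\dfrac{(m+1)(m^2-1)}{(m+2)(m^2+1)} & \text{if } m \text{ is odd}.\end{cases}$$ If the curvature operator of the second kind of $(M,g)$ is $C'$-nonnegative or $C'$-nonpositive for some real number $C'<C(m)$, then $(M,g)$ is flat.
   Context: Completeness of manifolds is not assumed. Write $n=2m$. Curvature convention: in a local orthonormal frame $e_1,\dots,e_n$, the components $R_{ijkl}$ of the curvature tensor are normalized so that $R_{ijij}$ is the sectional curvature of the plane spanned by $e_i,e_j$ ($i\ne j$). On (real) symmetric $(0,2)$-tensors at a point define the self-adjoint operator $\overline{R}$ by $(\overline{R}(h))_{ij}=\sum_{k,l}R_{iklj}h_{kl}$. The curvature operator of the second kind is the self-adjoint operator $\mathcal{R}=\mathrm{pr}\circ\overline{R}$ on the space $S_0^2(TM)$ of trace-free symmetric $(0,2)$-tensors at the point, where $\mathrm{pr}$ is the orthogonal projection onto $S^2_0(TM)$; equivalently $\mathcal{R}(h)=\overline{R}(h)+g(\mathrm{Ric},h)\frac{g}{n}$. Let $d=\dim S_0^2(TM)=\frac12(n-1)(n+2)$, and let $\lambda_1\le\dots\le\lambda_d$ be the eigenvalues of $\mathcal{R}$ at a point. For real $1\le k\le d$, $\mathcal{R}$ is $k$-nonnegative if at every point $\lambda_1+\dots+\lambda_{\lfloor k\rfloor}+(k-\lfloor k\rfloor)\lambda_{\lfloor k\rfloor+1}\ge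 0$ (the last term is omitted if $k$ is an integer), and $k$-nonpositive if $-\mathcal{R}$ is $k$-nonnegative. (In particular, for $m=1$ one has $C(1)=0$ and there is no admissible $C'$.) *)

theory Defs
  imports "HOL-Analysis.Analysis" "HOL-Library.Multiset"
begin

section \<open>Smooth functions on open subsets of coordinate space\<close>

definition partial_deriv :: "'n::finite \<Rightarrow> (real^'n \<Rightarrow> real) \<Rightarrow> real^'n \<Rightarrow> real" where
  "partial_deriv i f x = frechet_derivative f (at x) (axis i 1)"

text \<open>The following is only used for open \<open>S\<close>, where it is the usual notion of \<open>C\<^sup>k\<close>.\<close>

primrec Ck_on :: "nat \<Rightarrow> (real^'n::finite) set \<Rightarrow> (real^'n \<Rightarrow> real) \<Rightarrow> bool" where
  "Ck_on 0 S f \<longleftrightarrow> continuous_on S f"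
| "Ck_on (Suc k) S f \<longleftrightarrow>
     (\<forall>x\<in>S. f differentiable (at x)) \<and> (\<forall>i. Ck_on k S (partial_deriv i f))"

definition smooth_on :: "(real^'n::finite) set \<Rightarrow> (real^'n \<Rightarrow> real) \<Rightarrow> bool" where
  "smooth_on S f \<longleftrightarrow> (\<forall>k. Ck_on k S f)"


section \<open>Smooth, Riemannian and Kaehler manifolds\<close>

text \<open>
  A chart is a pair of its domain and its coordinate map. Tensor fields are given classically, by
  their matrix of components with respect to each chart of the atlas (as a function of the
  coordinates), subject to the transformation law on overlaps. Only values of these component
  functions at coordinates in the image of the chart are relevant.
\<close>

type_synonym ('a, 'n) chart = "'a set \<times> ('a \<Rightarrow> real^'n)"
type_synonym ('a, 'n) tensor_field = "('a, 'n) chart \<Rightarrow> real^'n \<Rightarrow> real^'n^'n"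

definition chart_image :: "('a, 'n::finite) chart \<Rightarrow> (real^'n) set" where
  "chart_image c = snd c ` fst c"

definition overlap :: "('a, 'n::finite) chart \<Rightarrow> ('a, 'n) chart \<Rightarrow> (real^'n) set" where
  "overlap c c' = snd c ` (fst c \<inter> fst c')"

definition transition :: "('a, 'n::finite) chart \<Rightarrow> ('a, 'n) chart \<Rightarrow> real^'n \<Rightarrow> real^'n" where
  "transition c c' = snd c' \<circ> inv_into (fst c) (snd c)"

locale smooth_manifold =
  fixes X :: "'a topology" and A :: "('a, 'n::finite) chart set"
  assumes hausdorff: "Hausdorff_space X"
    and second_countable: "second_countable X"
    and chart_domain: "c \<in> A \<Longrightarrow> openin X (fst c)"
    and chart_image_open: "c \<in> A \<Longrightarrow> open (chart_image c)"
    and chart_homeo: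
      "c \<in> A \<Longrightarrow> homeomorphic_map (subtopology X (fst c)) (top_of_set (chart_image c)) (snd c)"
    and charts_cover: "(\<Union>c\<in>A. fst c) = topspace X"
    and charts_compatible:
      "c \<in> A \<Longrightarrow> c' \<in> A \<Longrightarrow> smooth_on (overlap c c') (\<lambda>x. transition c c' x $ i)"

text \<open>\<open>g c x $ i $ j\<close> is the component \<open>g\<^sub>i\<^sub>j\<close> in the chart \<open>c\<close> at coordinates \<open>x\<close>.\<close>

locale riemannian_manifold = smooth_manifold X A
  for X :: "'a topology" and A :: "('a, 'n::finite) chart set" +
  fixes g :: "('a, 'n) tensor_field"
  assumes metric_smooth: "c \<in> A \<Longrightarrow> smooth_on (chart_image c) (\<lambda>x. g c x $ i $ j)"
    and metric_transform:
      "c \<in> A \<Longrightarrow> c' \<in> A \<Longrightarrow> x \<in> overlap c c' \<Longrightarrow>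
        g c x = transpose (jacobian (transition c c') (at x)) ** g c' (transition c c' x)
                  ** jacobian (transition c c') (at x)"
    and metric_sym: "c \<in> A \<Longrightarrow> x \<in> chart_image c \<Longrightarrow> transpose (g c x) = g c x"
    and metric_pos: "c \<in> A \<Longrightarrow> x \<in> chart_image c \<Longrightarrow> v \<noteq> 0 \<Longrightarrow> v \<bullet> (g c x *v v) > 0"

text \<open>
  In the following, \<open>G\<close> is the coordinate expression of a metric in one chart:
  \<open>christoffel G x k i j\<close> is \<open>\<Gamma>\<^sup>k\<^sub>i\<^sub>j\<close>, the coefficient of \<open>\<partial>\<^sub>k\<close> in \<open>\<nabla>\<^bsub>\<partial>\<^sub>i\<^esub> \<partial>\<^sub>j\<close>
  for the Levi-Civita connection.
\<close>

definition christoffel ::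
    "(real^'n \<Rightarrow> real^'n^'n) \<Rightarrow> real^'n \<Rightarrow> 'n::finite \<Rightarrow> 'n \<Rightarrow> 'n \<Rightarrow> real" where
  "christoffel G x k i j =
     (\<Sum>l\<in>UNIV. matrix_inv (G x) $ k $ l *
        (partial_deriv i (\<lambda>y. G y $ j $ l) x + partial_deriv j (\<lambda>y. G y $ i $ l) x
          - partial_deriv l (\<lambda>y. G y $ i $ j) x)) / 2"

text \<open>
  For an endomorphism field with components \<open>F x $ i $ j\<close> (upper index first),
  \<open>cov_deriv_endo G F x k i j\<close> is the component \<open>(\<nabla>\<^sub>k F)\<^sup>i\<^sub>j\<close>.
\<close>

definition cov_deriv_endo ::
    "(real^'n \<Rightarrow> real^'n^'n) \<Rightarrow> (real^'n \<Rightarrow> real^'n^'n) \<Rightarrow> real^'n \<Rightarrow> 'n::finite \<Rightarrow> 'n \<Rightarrow> 'n \<Rightarrow> real" where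
  "cov_deriv_endo G F x k i j =
     partial_deriv k (\<lambda>y. F y $ i $ j) x
     + (\<Sum>l\<in>UNIV. christoffel G x i k l * F x $ l $ j)
     - (\<Sum>l\<in>UNIV. christoffel G x l k j * F x $ i $ l)"

text \<open>
  A Kaehler manifold is a Riemannian manifold with an orthogonal almost complex structure that is
  parallel for the Levi-Civita connection.
\<close>

locale kaehler_manifold = riemannian_manifold X A g
  for X :: "'a topology" and A :: "('a, 'n::finite) chart set" and g :: "('a, 'n) tensor_field" +
  fixes J :: "('a, 'n) tensor_field"
  assumes J_smooth: "c \<in> A \<Longrightarrow> smooth_on (chart_image c) (\<lambda>x. J c x $ i $ j)"
    and J_transform:
      "c \<in> A \<Longrightarrow> c' \<in> A \<Longrightarrow> x \<in> overlap c c' \<Longrightarrow>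
        jacobian (transition c c') (at x) ** J c x
          = J c' (transition c c' x) ** jacobian (transition c c') (at x)"
    and J_square: "c \<in> A \<Longrightarrow> x \<in> chart_image c \<Longrightarrow> J c x ** J c x = - mat 1"
    and J_orthogonal:
      "c \<in> A \<Longrightarrow> x \<in> chart_image c \<Longrightarrow> transpose (J c x) ** g c x ** J c x = g c x"
    and J_parallel: "c \<in> A \<Longrightarrow> x \<in> chart_image c \<Longrightarrow> cov_deriv_endo (g c) (J c) x k i j = 0"


section \<open>Curvature\<close>

text \<open>
  \<open>curvature_comp G x i j l a\<close> is the coefficient of \<open>\<partial>\<^sub>a\<close> in \<open>R(\<partial>\<^sub>i, \<partial>\<^sub>j) \<partial>\<^sub>l\<close>, where
  \<open>R(Y, Z) = \<nabla>\<^sub>Y \<nabla>\<^sub>Z - \<nabla>\<^sub>Z \<nabla>\<^sub>Y - \<nabla>\<^bsub>[Y, Z]\<^esub>\<close>.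
\<close>

definition curvature_comp ::
    "(real^'n \<Rightarrow> real^'n^'n) \<Rightarrow> real^'n \<Rightarrow> 'n::finite \<Rightarrow> 'n \<Rightarrow> 'n \<Rightarrow> 'n \<Rightarrow> real" where
  "curvature_comp G x i j l a =
     partial_deriv i (\<lambda>y. christoffel G y a j l) x - partial_deriv j (\<lambda>y. christoffel G y a i l) x
     + (\<Sum>b\<in>UNIV. christoffel G x a i b * christoffel G x b j l
                 - christoffel G x a j b * christoffel G x b i l)"

text \<open>
  The lowered tensor is \<open>Rm(u, v, w, z) = g(R(u, v) z, w)\<close>, so that \<open>Rm(u, v, u, v)\<close> is the
  sectional curvature for orthonormal \<open>u\<close>, \<open>v\<close>.
\<close>

definition Rm ::
    "(real^'n \<Rightarrow> real^'n^'n) \<Rightarrow> real^'n \<Rightarrow> real^'n \<Rightarrow> real^'n \<Rightarrow> real^'n \<Rightarrow> real^'n::finite \<Rightarrow> real" where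
  "Rm G x u v w z =
     (\<Sum>i\<in>UNIV. \<Sum>j\<in>UNIV. \<Sum>k\<in>UNIV. \<Sum>l\<in>UNIV. \<Sum>a\<in>UNIV.
        u $ i * v $ j * w $ k * z $ l * G x $ k $ a * curvature_comp G x i j l a)"

definition flat :: "('a, 'n::finite) chart set \<Rightarrow> ('a, 'n) tensor_field \<Rightarrow> bool" where
  "flat A g \<longleftrightarrow> (\<forall>c\<in>A. \<forall>x\<in>chart_image c. \<forall>u v w z. Rm (g c) x u v w z = 0)"

text \<open>A basis of the tangent space is given by the coordinate vectors of its elements.\<close>

definition orthonormal_frame :: "real^'n^'n \<Rightarrow> ('n::finite \<Rightarrow> real^'n) \<Rightarrow> bool" where
  "orthonormal_frame Gx e \<longleftrightarrow> (\<forall>i j. e i \<bullet> (Gx *v e j) = (if i = j then 1 else 0))"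


section \<open>The curvature operator of the second kind\<close>

text \<open>
  With respect to an orthonormal frame, a \<open>(0,2)\<close>-tensor at a point is the matrix of its
  components, and \<open>R i j k l\<close> are the components of the curvature tensor.
\<close>

definition S20 :: "(real^'n^'n::finite) set" where
  "S20 = {h. transpose h = h \<and> trace h = 0}"

definition pr_S20 :: "real^'n^'n \<Rightarrow> real^'n^'n::finite" where
  "pr_S20 h = h - (trace h / real CARD('n)) *\<^sub>R mat 1"

lemma pr_S20_orthogonal_projection:
  fixes h :: "real^'n^'n::finite"
  assumes "transpose h = h"
  shows "pr_S20 h \<in> S20" and "a \<in> S20 \<Longrightarrow> (h - pr_S20 h) \<bullet> a = 0"
proof -
  have tr: "mat 1 \<bullet> (b :: real^'n^'n) = trace b" for b
    by (simp add: inner_vec_def mat_def trace_def if_distrib[of "\<lambda>t. t * _"] cong: if_cong)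
  have "trace (pr_S20 h) = 0"
    by (simp add: pr_S20_def trace_def mat_def sum_subtractf)
  moreover have "transpose (pr_S20 h) = pr_S20 h"
    using assms by (auto simp: pr_S20_def transpose_def mat_def vec_eq_iff)
  ultimately show "pr_S20 h \<in> S20"
    by (simp add: S20_def)
  show "a \<in> S20 \<Longrightarrow> (h - pr_S20 h) \<bullet> a = 0"
    by (simp add: pr_S20_def S20_def tr)
qed

definition R_bar :: "('n \<Rightarrow> 'n \<Rightarrow> 'n \<Rightarrow> 'n \<Rightarrow> real) \<Rightarrow> real^'n^'n \<Rightarrow> real^'n^'n::finite" where
  "R_bar R h = (\<chi> i j. \<Sum>k\<in>UNIV. \<Sum>l\<in>UNIV. R i k l j * h $ k $ l)"

definition curv_op2 :: "('n \<Rightarrow> 'n \<Rightarrow> 'n \<Rightarrow> 'n \<Rightarrow> real) \<Rightarrow> real^'n^'n \<Rightarrow> real^'n^'n::finite" where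
  "curv_op2 R = pr_S20 \<circ> R_bar R"

definition curv_op2_at ::
    "(real^'n \<Rightarrow> real^'n^'n) \<Rightarrow> real^'n \<Rightarrow> ('n \<Rightarrow> real^'n) \<Rightarrow> real^'n^'n \<Rightarrow> real^'n^'n::finite" where
  "curv_op2_at G x e = curv_op2 (\<lambda>i j k l. Rm G x (e i) (e j) (e k) (e l))"


section \<open>Weighted eigenvalue sums\<close>

text \<open>
  \<open>ls\<close> lists the eigenvalues of the operator \<open>T\<close> on the subspace \<open>V\<close> in nondecreasing order and
  with multiplicity. The length condition expresses that \<open>T\<close> is diagonalizable on \<open>V\<close>, which
  is automatic if it is self-adjoint.
\<close>

definition eigenvalue_list :: "'v::euclidean_space set \<Rightarrow> ('v \<Rightarrow> 'v) \<Rightarrow> real list \<Rightarrow> bool" where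
  "eigenvalue_list V T ls \<longleftrightarrow>
     sorted ls \<and> length ls = dim V \<and> (\<forall>\<mu>. count (mset ls) \<mu> = dim {h \<in> V. T h = \<mu> *\<^sub>R h})"

lemma eigenvalue_list_unique:
  assumes "eigenvalue_list V T ls" "eigenvalue_list V T ls'"
  shows "ls = ls'"
  using assms unfolding eigenvalue_list_def
  by (metis multiset_eqI properties_for_sort)

text \<open>The list is indexed from 0, so \<open>ls ! i\<close> is \<open>\<lambda>\<^bsub>i+1\<^esub>\<close>.\<close>

definition weighted_sum :: "real list \<Rightarrow> real \<Rightarrow> real" where
  "weighted_sum ls k =
     (\<Sum>i<nat \<lfloor>k\<rfloor>. ls ! i) + (if k \<in> \<int> then 0 else (k - of_int \<lfloor>k\<rfloor>) * ls ! nat \<lfloor>k\<rfloor>)"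

definition k_nonneg_op :: "'v::euclidean_space set \<Rightarrow> ('v \<Rightarrow> 'v) \<Rightarrow> real \<Rightarrow> bool" where
  "k_nonneg_op V T k \<longleftrightarrow> (\<exists>ls. eigenvalue_list V T ls \<and> weighted_sum ls k \<ge> 0)"

text \<open>
  The eigenvalues do not depend on the chart or on the orthonormal frame, so it does not matter
  which ones are used at a given point.
\<close>

definition k_nonnegative ::
    "('a, 'n::finite) chart set \<Rightarrow> ('a, 'n) tensor_field \<Rightarrow> real \<Rightarrow> bool" where
  "k_nonnegative A g k \<longleftrightarrow>
     1 \<le> k \<and> k \<le> real (dim (S20 :: (real^'n^'n) set)) \<and>
     (\<forall>c\<in>A. \<forall>x\<in>chart_image c. \<exists>e. orthonormal_frame (g c x) e \<and>
        k_nonneg_op S20 (curv_op2_at (g c) x e) k)"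

definition k_nonpositive ::
    "('a, 'n::finite) chart set \<Rightarrow> ('a, 'n) tensor_field \<Rightarrow> real \<Rightarrow> bool" where
  "k_nonpositive A g k \<longleftrightarrow>
     1 \<le> k \<and> k \<le> real (dim (S20 :: (real^'n^'n) set)) \<and>
     (\<forall>c\<in>A. \<forall>x\<in>chart_image c. \<exists>e. orthonormal_frame (g c x) e \<and>
        k_nonneg_op S20 (\<lambda>h. - curv_op2_at (g c) x e h) k)"

definition kaehler_const :: "nat \<Rightarrow> real" where
  "kaehler_const m =
     (if even m then 3 * real m * ((real m + 1) / (real m + 2))
      else 3 * real m * (((real m + 1) * ((real m)\<^sup>2 - 1)) / ((real m + 2) * ((real m)\<^sup>2 + 1))))"

end

theory Submission
  imports Defs
begin

text \<open>
  The argument is pointwise and rests on one trace identity. At a point, let \<open>\<R>\<close> be the curvature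
  operator of the second kind on the trace-free symmetric tensors. These split into
  \<open>J\<close>-invariant ones, of dimension \<open>m\<^sup>2 - 1\<close>, and \<open>J\<close>-anti-invariant ones, of dimension
  \<open>m (m + 1)\<close>. The trace of \<open>\<R>\<close> over either part is a unitarily invariant linear functional of the
  curvature tensor, hence a universal multiple of the scalar curvature. So some weight makes the
  weighted trace vanish identically: if \<open>A\<close> is the identity on the invariant part and
  \<open>(m - 1) / (2 m)\<close> on the anti-invariant part, then \<open>tr (\<R> A) = 0\<close> for every Kaehler curvature
  tensor, while \<open>tr A = 3/2 (m\<^sup>2 - 1)\<close>. In terms of the complex structure,
  \<open>A h = \<alpha> h + \<beta> h(J\<cdot>, J\<cdot>)\<close>, and both traces are computed by contracting with the kernel of the
  projection onto trace-free symmetric matrices (\<open>entry_products_sum\<close>, \<open>trace_R_bar\<close>,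
  \<open>trace_R_bar_J_conj\<close>); apart from the symmetries of any curvature tensor, only its
  invariance under \<open>J\<close> enters.

  In an orthonormal eigenbasis of \<open>\<R>\<close> the identity reads \<open>\<Sum> a\<^sub>i \<lambda>\<^sub>i = 0\<close> with weights
  \<open>0 < a\<^sub>i \<le> 1\<close> of total \<open>3/2 (m\<^sup>2 - 1)\<close>, provided that \<open>m \<ge> 2\<close>. If the sum of the \<open>k\<close> smallest
  eigenvalues is nonnegative for some \<open>k \<ge> 1\<close> below this total, a rearrangement argument forces all
  eigenvalues to vanish (\<open>weighted_sum_nonneg_imp_zero\<close>). Then \<open>\<R> = 0\<close>, and this determines the
  whole curvature tensor (\<open>curv_op2_zero_imp_zero\<close>). The same applies to \<open>-\<R>\<close>. Finally
  \<open>C(m) \<le> 3/2 (m\<^sup>2 - 1)\<close> for \<open>m \<ge> 2\<close>, and \<open>m = 1\<close> is excluded because \<open>C(1) = 0\<close>.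

  The algebraic symmetries used at a point have to be derived from the coordinate definition of
  the curvature. The metric and the complex structure are parallel, which gives first-order systems
  for their matrices; differentiating once more and using that partial derivatives commute
  (\<open>partial_deriv_commute\<close>) shows that the curvature endomorphisms are skew
  (\<open>curvature_skew\<close>) and commute with the complex structure (\<open>curvature_commutes_J\<close>).
\<close>

section \<open>Partial derivatives\<close>

lemma partial_deriv_along_axis:
  fixes f :: "real^'n::finite \<Rightarrow> real"
  assumes "f differentiable (at x)" and that: "x = y + s *\<^sub>R axis i 1"
  shows "((\<lambda>s. f (y + s *\<^sub>R axis i 1)) has_real_derivative partial_deriv i f x) (at s)"
proof -
  have "(f has_derivative frechet_derivative f (at x)) (at (y + s *\<^sub>R axis i 1))"
    using assms that frechet_derivative_works by blast
  moreover have "((\<lambda>s. y + s *\<^sub>R axis i 1) has_derivative (\<lambda>t. t *\<^sub>R axis i 1)) (at s)"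
    by (auto intro!: derivative_eq_intros)
  ultimately have "((\<lambda>s. f (y + s *\<^sub>R axis i 1)) has_derivative
      (\<lambda>t. frechet_derivative f (at x) (t *\<^sub>R axis i 1))) (at s)"
    using has_derivative_compose by fastforce
  moreover have "frechet_derivative f (at x) (t *\<^sub>R axis i 1) = partial_deriv i f x * t" for t
    using linear_frechet_derivative[OF assms(1)] by (simp add: linear_scale partial_deriv_def)
  ultimately show ?thesis
    by (simp add: has_field_derivative_def)
qed

lemma partial_deriv_eq:
  assumes "(f has_derivative f') (at x)"
  shows "partial_deriv i f x = f' (axis i 1)"
  using frechet_derivative_at[OF assms] by (simp add: partial_deriv_def)

lemma partial_deriv_cong_open:
  fixes f h :: "real^'n::finite \<Rightarrow> real"
  assumes "open S" "x \<in> S" "\<And>y. y \<in> S \<Longrightarrow> f y = h y"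
  shows "partial_deriv i f x = partial_deriv i h x"
proof -
  have "(f has_derivative f') (at x) \<longleftrightarrow> (h has_derivative f') (at x)" for f'
    using assms by (metis has_derivative_transform_within_open)
  then show ?thesis
    by (simp add: partial_deriv_def frechet_derivative_def)
qed

lemma differentiable_cong_open:
  fixes f h :: "real^'n::finite \<Rightarrow> real"
  assumes "open S" "x \<in> S" "\<And>y. y \<in> S \<Longrightarrow> f y = h y" "h differentiable (at x)"
  shows "f differentiable (at x)"
  using assms unfolding differentiable_def
  by (metis has_derivative_transform_within_open)

lemma partial_deriv_mult:
  assumes "f differentiable (at x)" "h differentiable (at x)"
  shows "partial_deriv i (\<lambda>y. f y * h y) x = partial_deriv i f x * h x + f x * partial_deriv i h x"
proof -
  from assms obtain f' h' where d: "(f has_derivative f') (at x)" "(h has_derivative h') (at x)"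
    unfolding differentiable_def by blast
  show ?thesis
    by (subst partial_deriv_eq[OF has_derivative_mult[OF d]])
       (simp add: partial_deriv_eq[OF d(1)] partial_deriv_eq[OF d(2)])
qed

lemma partial_deriv_add:
  assumes "f differentiable (at x)" "h differentiable (at x)"
  shows "partial_deriv i (\<lambda>y. f y + h y) x = partial_deriv i f x + partial_deriv i h x"
proof -
  from assms obtain f' h' where d: "(f has_derivative f') (at x)" "(h has_derivative h') (at x)"
    unfolding differentiable_def by blast
  show ?thesis
    by (subst partial_deriv_eq[OF has_derivative_add[OF d]])
       (simp add: partial_deriv_eq[OF d(1)] partial_deriv_eq[OF d(2)])
qed

lemma partial_deriv_diff:
  assumes "f differentiable (at x)" "h differentiable (at x)"
  shows "partial_deriv i (\<lambda>y. f y - h y) x = partial_deriv i f x - partial_deriv i h x"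
proof -
  from assms obtain f' h' where d: "(f has_derivative f') (at x)" "(h has_derivative h') (at x)"
    unfolding differentiable_def by blast
  show ?thesis
    by (subst partial_deriv_eq[OF has_derivative_diff[OF d]])
       (simp add: partial_deriv_eq[OF d(1)] partial_deriv_eq[OF d(2)])
qed

lemma partial_deriv_sum:
  assumes "\<And>a. a \<in> I \<Longrightarrow> f a differentiable (at x)"
  shows "partial_deriv i (\<lambda>y. \<Sum>a\<in>I. f a y) x = (\<Sum>a\<in>I. partial_deriv i (f a) x)"
proof -
  have "((\<lambda>y. \<Sum>a\<in>I. f a y) has_derivative (\<lambda>v. \<Sum>a\<in>I. frechet_derivative (f a) (at x) v)) (at x)"
    using assms by (intro has_derivative_sum) (simp add: frechet_derivative_works)
  from partial_deriv_eq[OF this] show ?thesis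
    by (simp add: partial_deriv_def)
qed

text \<open>Two applications of the mean value theorem, first along \<open>e\<^sub>i\<close> and then along \<open>e\<^sub>j\<close>. The left-hand
  side is symmetric in \<open>i\<close> and \<open>j\<close>, which is what makes the mixed partial derivatives agree.\<close>

lemma second_difference_mean_value:
  fixes f :: "real^'n::finite \<Rightarrow> real"
  assumes r: "0 < h" "2 * h < r"
    and df: "\<And>y. y \<in> ball x r \<Longrightarrow> f differentiable (at y)"
    and ddf: "\<And>y. y \<in> ball x r \<Longrightarrow> partial_deriv i f differentiable (at y)"
  obtains p where "dist x p \<le> 2 * h"
    "f (x + h *\<^sub>R axis i 1 + h *\<^sub>R axis j 1) - f (x + h *\<^sub>R axis i 1) - f (x + h *\<^sub>R axis j 1) + f x
       = h * h * partial_deriv j (partial_deriv i f) p"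
proof -
  let ?i = "axis i 1 :: real^'n" and ?j = "axis j 1 :: real^'n"
  have near: "dist x (x + s *\<^sub>R ?i + t *\<^sub>R ?j) \<le> 2 * h" if "0 \<le> s" "s \<le> h" "0 \<le> t" "t \<le> h" for s t
  proof -
    have "dist x (x + s *\<^sub>R ?i + t *\<^sub>R ?j) = norm (s *\<^sub>R ?i + t *\<^sub>R ?j)"
      by (metis add.assoc add_diff_cancel_left' dist_commute dist_norm)
    also have "\<dots> \<le> norm (s *\<^sub>R ?i) + norm (t *\<^sub>R ?j)"
      by (rule norm_triangle_ineq)
    finally show ?thesis using that by (simp)
  qed
  have inb: "x + s *\<^sub>R ?i + t *\<^sub>R ?j \<in> ball x r" if "0 \<le> s" "s \<le> h" "0 \<le> t" "t \<le> h" for s t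
    using near[OF that] r by simp
  define u where "u s = f ((x + h *\<^sub>R ?j) + s *\<^sub>R ?i) - f (x + s *\<^sub>R ?i)" for s
  have "(u has_real_derivative partial_deriv i f (x + s *\<^sub>R ?i + h *\<^sub>R ?j)
        - partial_deriv i f (x + s *\<^sub>R ?i)) (at s)" if "0 \<le> s" "s \<le> h" for s
  proof -
    have "f differentiable (at (x + s *\<^sub>R ?i + h *\<^sub>R ?j))" "f differentiable (at (x + s *\<^sub>R ?i))"
      using df inb[OF that, of h] inb[OF that, of 0] r by auto
    then show ?thesis
      unfolding u_def
      by (intro DERIV_diff partial_deriv_along_axis) (auto simp: algebra_simps)
  qed
  from MVT2[OF r(1) this] obtain s where s: "0 < s" "s < h"
    "u h - u 0 = h * (partial_deriv i f (x + s *\<^sub>R ?i + h *\<^sub>R ?j) - partial_deriv i f (x + s *\<^sub>R ?i))"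
    by auto
  have "((\<lambda>t. partial_deriv i f ((x + s *\<^sub>R ?i) + t *\<^sub>R ?j)) has_real_derivative
     partial_deriv j (partial_deriv i f) (x + s *\<^sub>R ?i + t *\<^sub>R ?j)) (at t)" if "0 \<le> t" "t \<le> h" for t
    using ddf[OF inb[of s t]] s that
    by (intro partial_deriv_along_axis) auto
  from MVT2[OF r(1) this] obtain t where t: "0 < t" "t < h"
    "partial_deriv i f (x + s *\<^sub>R ?i + h *\<^sub>R ?j) - partial_deriv i f (x + s *\<^sub>R ?i)
       = h * partial_deriv j (partial_deriv i f) (x + s *\<^sub>R ?i + t *\<^sub>R ?j)"
    by auto
  show ?thesis
  proof
    show "dist x (x + s *\<^sub>R ?i + t *\<^sub>R ?j) \<le> 2 * h"
      using near s t by simp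
    show "f (x + h *\<^sub>R ?i + h *\<^sub>R ?j) - f (x + h *\<^sub>R ?i) - f (x + h *\<^sub>R ?j) + f x
       = h * h * partial_deriv j (partial_deriv i f) (x + s *\<^sub>R ?i + t *\<^sub>R ?j)"
      using s(3) unfolding t(3) by (simp add: u_def algebra_simps)
  qed
qed

text \<open>Schwarz's theorem: second differences on small squares at \<open>x\<close> are values of either mixed
  derivative at points near \<open>x\<close>, so continuity leaves no room for the two to differ.\<close>

theorem partial_deriv_commute:
  fixes f :: "real^'n::finite \<Rightarrow> real"
  assumes "open S" "x \<in> S"
    and df: "\<And>y. y \<in> S \<Longrightarrow> f differentiable (at y)"
    and ddf: "\<And>y k. y \<in> S \<Longrightarrow> partial_deriv k f differentiable (at y)"
    and cont: "\<And>k l. continuous_on S (partial_deriv k (partial_deriv l f))"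
  shows "partial_deriv i (partial_deriv j f) x = partial_deriv j (partial_deriv i f) x"
proof (rule ccontr)
  let ?p = "partial_deriv i (partial_deriv j f)" and ?q = "partial_deriv j (partial_deriv i f)"
  define e where "e = \<bar>?p x - ?q x\<bar> / 2"
  assume "?p x \<noteq> ?q x"
  then have e: "e > 0" by (simp add: e_def)
  obtain r where r: "r > 0" "ball x r \<subseteq> S"
    using assms openE by blast
  have "isCont ?p x" "isCont ?q x"
    using cont assms by (auto simp: continuous_on_eq_continuous_at)
  then obtain d1 d2 where d: "d1 > 0" "\<And>y. dist y x < d1 \<Longrightarrow> dist (?p y) (?p x) < e"
      "d2 > 0" "\<And>y. dist y x < d2 \<Longrightarrow> dist (?q y) (?q x) < e"
    using e unfolding continuous_at_eps_delta by metis
  \<comment> \<open>Mean value points lie within distance \<open>2 h\<close> of \<open>x\<close>, which has to stay below all three radii.\<close>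
  define h where "h = min r (min d1 d2) / 3"
  have h: "0 < h" "2 * h < r" "2 * h < d1" "2 * h < d2"
    using r d by (auto simp: h_def)
  have near: "f differentiable (at y)" "partial_deriv k f differentiable (at y)" if "y \<in> ball x r" for y k
    using df ddf r(2) that by auto
  obtain p where p: "dist x p \<le> 2 * h"
    "f (x + h *\<^sub>R axis j 1 + h *\<^sub>R axis i 1) - f (x + h *\<^sub>R axis j 1) - f (x + h *\<^sub>R axis i 1) + f x
       = h * h * ?p p"
    by (rule second_difference_mean_value[OF h(1,2) near]) auto
  obtain q where q: "dist x q \<le> 2 * h"
    "f (x + h *\<^sub>R axis i 1 + h *\<^sub>R axis j 1) - f (x + h *\<^sub>R axis i 1) - f (x + h *\<^sub>R axis j 1) + f x
       = h * h * ?q q"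
    by (rule second_difference_mean_value[OF h(1,2) near]) auto
  have "h * h * ?p p = h * h * ?q q"
    using p(2) q(2) by (simp add: algebra_simps)
  then have "?p p = ?q q"
    using h(1) by simp
  moreover have "dist (?p p) (?p x) < e" "dist (?q q) (?q x) < e"
    using d p(1) q(1) h by (auto simp: dist_commute)
  ultimately have "\<bar>?p x - ?q x\<bar> < e + e"
    unfolding dist_real_def by linarith
  then show False
    by (simp add: e_def)
qed

lemma smooth_on_partial_deriv: "smooth_on S f \<Longrightarrow> smooth_on S (partial_deriv i f)"
  unfolding smooth_on_def using Ck_on.simps(2) by blast

lemma smooth_on_differentiable: "smooth_on S f \<Longrightarrow> x \<in> S \<Longrightarrow> f differentiable (at x)"
  unfolding smooth_on_def using Ck_on.simps(2) by blast

lemma smooth_on_continuous: "smooth_on S f \<Longrightarrow> continuous_on S f"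
  unfolding smooth_on_def using Ck_on.simps(1) by blast

lemma smooth_partial_deriv_commute:
  assumes "open S" "x \<in> S" "smooth_on S f"
  shows "partial_deriv i (partial_deriv j f) x = partial_deriv j (partial_deriv i f) x"
  using assms
  by (intro partial_deriv_commute[of S])
     (auto intro: smooth_on_differentiable smooth_on_continuous smooth_on_partial_deriv)


section \<open>Matrix-valued functions\<close>

text \<open>
  Writing tensor fields as matrix-valued functions turns the curvature identities into computations
  with matrix products. Differentiability is imposed entrywise, so that the smoothness of component
  functions can be used directly.
\<close>

definition mdiff :: "(real^'n \<Rightarrow> real^'n^'n) \<Rightarrow> real^'n::finite \<Rightarrow> bool" where
  "mdiff F x \<longleftrightarrow> (\<forall>a b. (\<lambda>y. F y $ a $ b) differentiable (at x))"

definition msmooth :: "(real^'n) set \<Rightarrow> (real^'n \<Rightarrow> real^'n^'n::finite) \<Rightarrow> bool" where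
  "msmooth S F \<longleftrightarrow> (\<forall>a b. smooth_on S (\<lambda>y. F y $ a $ b))"

definition mpartial :: "'n \<Rightarrow> (real^'n \<Rightarrow> real^'n^'n) \<Rightarrow> real^'n \<Rightarrow> real^'n^'n::finite" where
  "mpartial i F x = (\<chi> a b. partial_deriv i (\<lambda>y. F y $ a $ b) x)"

lemma mpartial_cong_open:
  assumes "open S" "x \<in> S" "\<And>y. y \<in> S \<Longrightarrow> F y = H y"
  shows "mpartial i F x = mpartial i H x"
  unfolding mpartial_def by (auto simp: vec_eq_iff intro!: partial_deriv_cong_open[OF assms(1,2)] simp: assms(3))

lemma mpartial_mult:
  assumes "mdiff F x" "mdiff H x"
  shows "mpartial i (\<lambda>y. F y ** H y) x = mpartial i F x ** H x + F x ** mpartial i H x"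
    and "mdiff (\<lambda>y. F y ** H y) x"
  using assms
  by (auto simp: vec_eq_iff mpartial_def mdiff_def matrix_matrix_mult_def partial_deriv_sum
      partial_deriv_mult sum.distrib intro!: differentiable_sum differentiable_mult)

lemma mpartial_add:
  assumes "mdiff F x" "mdiff H x"
  shows "mpartial i (\<lambda>y. F y + H y) x = mpartial i F x + mpartial i H x"
  using assms by (auto simp: vec_eq_iff mpartial_def mdiff_def partial_deriv_add)

lemma mpartial_diff:
  assumes "mdiff F x" "mdiff H x"
  shows "mpartial i (\<lambda>y. F y - H y) x = mpartial i F x - mpartial i H x"
  using assms by (auto simp: vec_eq_iff mpartial_def mdiff_def partial_deriv_diff)

lemma mpartial_transpose: "mpartial i (\<lambda>y. transpose (F y)) x = transpose (mpartial i F x)"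
  by (simp add: vec_eq_iff mpartial_def transpose_def)

lemma mdiff_transpose: "mdiff F x \<Longrightarrow> mdiff (\<lambda>y. transpose (F y)) x"
  by (simp add: mdiff_def transpose_def)

lemma msmooth_mdiff: "msmooth S F \<Longrightarrow> x \<in> S \<Longrightarrow> mdiff F x"
  by (auto simp: msmooth_def mdiff_def intro: smooth_on_differentiable)

lemma mpartial_commute:
  assumes "open S" "x \<in> S" "msmooth S F"
  shows "mpartial i (mpartial j F) x = mpartial j (mpartial i F) x"
  using smooth_partial_deriv_commute[OF assms(1,2)] assms(3)
  by (simp add: vec_eq_iff mpartial_def msmooth_def)

lemma differentiable_prod:
  fixes f :: "'i \<Rightarrow> 'v::real_normed_vector \<Rightarrow> real"
  assumes "\<And>i. i \<in> I \<Longrightarrow> f i differentiable (at x)"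
  shows "(\<lambda>y. \<Prod>i\<in>I. f i y) differentiable (at x)"
  using assms by (induction I rule: infinite_finite_induct) (auto intro!: differentiable_mult)

lemma differentiable_det:
  fixes F :: "real^'n \<Rightarrow> real^'k^'k::finite"
  assumes "\<And>a b. (\<lambda>y. F y $ a $ b) differentiable (at x)"
  shows "(\<lambda>y. det (F y)) differentiable (at x)"
  unfolding det_def
  by (intro differentiable_sum ballI finite differentiable_mult differentiable_prod differentiable_const
      assms)

text \<open>Cramer's rule writes the entries of the inverse as quotients of determinants, hence as
  rational functions of the entries of the matrix.\<close>

lemma invertible_matrix_inv:
  assumes "invertible B"
  shows "B ** matrix_inv B = mat 1" "matrix_inv B ** B = mat 1"
proof -
  have "B ** matrix_inv B = mat 1 \<and> matrix_inv B ** B = mat 1"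
    using assms unfolding matrix_inv_def invertible_def by (rule someI_ex)
  then show "B ** matrix_inv B = mat 1" "matrix_inv B ** B = mat 1" by auto
qed

lemma matrix_inv_entry:
  fixes B :: "real^'n^'n::finite"
  assumes "invertible B"
  shows "matrix_inv B $ k $ l = det (\<chi> i j. if j = k then axis l 1 $ i else B $ i $ j) / det B"
proof -
  have "B *v (matrix_inv B *v axis l 1) = axis l 1"
    using assms by (simp add: matrix_vector_mul_assoc invertible_matrix_inv)
  then have "matrix_inv B *v axis l 1
      = (\<chi> k. det (\<chi> i j. if j = k then axis l 1 $ i else B $ i $ j) / det B)"
    using assms cramer invertible_det_nz by blast
  moreover have "(matrix_inv B *v axis l 1) $ k = matrix_inv B $ k $ l"
    by (simp add: matrix_vector_mult_basis column_def)
  ultimately show ?thesis by simp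
qed

lemma differentiable_matrix_inv:
  fixes F :: "real^'n \<Rightarrow> real^'n^'n::finite"
  assumes "open S" "x \<in> S" "\<And>y. y \<in> S \<Longrightarrow> invertible (F y)" "mdiff F x"
  shows "(\<lambda>y. matrix_inv (F y) $ k $ l) differentiable (at x)"
proof (rule differentiable_cong_open[OF assms(1,2)])
  show "matrix_inv (F y) $ k $ l
      = det (\<chi> i j. if j = k then axis l 1 $ i else F y $ i $ j) / det (F y)" if "y \<in> S" for y
    using assms(3)[OF that] by (rule matrix_inv_entry)
  have "(\<lambda>y. det (F y)) differentiable (at x)"
    using assms(4) by (intro differentiable_det) (auto simp: mdiff_def)
  moreover have "(\<lambda>y. det (\<chi> i j. if j = k then axis l 1 $ i else F y $ i $ j)) differentiable (at x)"
  proof (intro differentiable_det)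
    show "(\<lambda>y. (\<chi> i j. if j = k then axis l 1 $ i else F y $ i $ j) $ a $ b) differentiable (at x)"
      for a b
      using assms(4) by (cases "b = k") (simp_all add: mdiff_def)
  qed
  moreover have "det (F x) \<noteq> 0"
    using assms(2,3) invertible_det_nz by blast
  ultimately show "(\<lambda>y. det (\<chi> i j. if j = k then axis l 1 $ i else F y $ i $ j) / det (F y))
      differentiable (at x)"
    by (intro differentiable_divide) auto
qed


section \<open>Curvature identities in a chart\<close>

lemma transpose_add: "transpose (P + Q) = transpose P + transpose Q"
  by (simp add: vec_eq_iff transpose_def)

lemma transpose_diff: "transpose (P - Q) = transpose P - transpose (Q :: 'a::ab_group_add^'n^'m)"
  by (simp add: vec_eq_iff transpose_def)

lemma matrix_diff_ldistrib: "P ** (Q - R) = P ** Q - P ** (R :: 'a::ring_1^'n^'k)"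
  by (simp add: vec_eq_iff matrix_matrix_mult_def right_diff_distrib sum_subtractf)

lemma matrix_diff_rdistrib: "(P - Q) ** R = P ** R - Q ** (R :: 'a::ring_1^'n^'k)"
  by (simp add: vec_eq_iff matrix_matrix_mult_def left_diff_distrib sum_subtractf)

lemma matrix_add_rdistrib: "(P + Q) ** R = P ** R + Q ** (R :: 'a::semiring_1^'n^'k)"
  by (simp add: vec_eq_iff matrix_matrix_mult_def distrib_right sum.distrib)

lemma uminus_matrix_vector_mult: "(- P) *v x = - (P *v (x :: 'a::ring_1^'n))"
  by (simp add: vec_eq_iff matrix_vector_mult_def sum_negf)

lemma matrix_vector_mult_uminus: "P *v (- x) = - (P *v (x :: 'a::ring_1^'n))"
  by (simp add: vec_eq_iff matrix_vector_mult_def sum_negf)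

lemmas matrix_distribs = matrix_add_ldistrib matrix_add_rdistrib matrix_diff_ldistrib matrix_diff_rdistrib

text \<open>With these matrices the covariant derivative of a vector field is \<open>\<nabla>\<^sub>i = \<partial>\<^sub>i + \<Gamma>\<^sub>i\<close>, and the
  endomorphism \<open>R(\<partial>\<^sub>i, \<partial>\<^sub>j)\<close> becomes
  \<open>\<partial>\<^sub>i \<Gamma>\<^sub>j - \<partial>\<^sub>j \<Gamma>\<^sub>i + \<Gamma>\<^sub>i \<Gamma>\<^sub>j - \<Gamma>\<^sub>j \<Gamma>\<^sub>i\<close>.\<close>

definition conn_matrix :: "(real^'n \<Rightarrow> real^'n^'n) \<Rightarrow> 'n::finite \<Rightarrow> real^'n \<Rightarrow> real^'n^'n" where
  "conn_matrix G i x = (\<chi> a j. christoffel G x a i j)"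

definition curv_matrix :: "(real^'n \<Rightarrow> real^'n^'n) \<Rightarrow> real^'n \<Rightarrow> 'n::finite \<Rightarrow> 'n \<Rightarrow> real^'n^'n" where
  "curv_matrix G x i j = (\<chi> a l. curvature_comp G x i j l a)"

lemma curv_matrix_eq:
  "curv_matrix G x i j = mpartial i (conn_matrix G j) x - mpartial j (conn_matrix G i) x
     + conn_matrix G i x ** conn_matrix G j x - conn_matrix G j x ** conn_matrix G i x"
  by (simp add: vec_eq_iff curv_matrix_def mpartial_def conn_matrix_def curvature_comp_def
      matrix_matrix_mult_def sum_subtractf)

lemma curv_matrix_antisym: "curv_matrix G x i j = - curv_matrix G x j i"
  by (simp add: curv_matrix_eq)

lemma Rm_eq_curv_matrix:
  "Rm G x u v w z = (\<Sum>i\<in>UNIV. \<Sum>j\<in>UNIV. u $ i * v $ j * (w \<bullet> (G x *v (curv_matrix G x i j *v z))))"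
proof -
  have "u $ i * v $ j * (w \<bullet> (G x *v (curv_matrix G x i j *v z))) =
     (\<Sum>k\<in>UNIV. \<Sum>l\<in>UNIV. \<Sum>a\<in>UNIV. u $ i * v $ j * w $ k * z $ l * G x $ k $ a * curvature_comp G x i j l a)"
    for i j
  proof -
    have "u $ i * v $ j * (w \<bullet> (G x *v (curv_matrix G x i j *v z))) =
     (\<Sum>k\<in>UNIV. \<Sum>a\<in>UNIV. \<Sum>l\<in>UNIV. u $ i * v $ j * w $ k * z $ l * G x $ k $ a * curvature_comp G x i j l a)"
      by (simp add: inner_vec_def matrix_vector_mult_def curv_matrix_def sum_distrib_left
          sum_distrib_right mult_ac)
    also have "\<dots> = (\<Sum>k\<in>UNIV. \<Sum>l\<in>UNIV. \<Sum>a\<in>UNIV. u $ i * v $ j * w $ k * z $ l * G x $ k $ a * curvature_comp G x i j l a)"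
      by (rule sum.cong[OF refl], rule sum.swap)
    finally show ?thesis .
  qed
  then show ?thesis
    by (simp add: Rm_def)
qed

text \<open>Curvature is computed inside one chart, so the data are a metric and a complex structure on an
  open set of coordinate space.\<close>

locale kaehler_chart =
  fixes S :: "(real^'n::finite) set" and G J :: "real^'n \<Rightarrow> real^'n^'n"
  assumes open_S: "open S"
    and smooth_G: "msmooth S G"
    and sym_G: "\<And>x. x \<in> S \<Longrightarrow> transpose (G x) = G x"
    and pos_G: "\<And>x v. x \<in> S \<Longrightarrow> v \<noteq> 0 \<Longrightarrow> v \<bullet> (G x *v v) > 0"
    and smooth_J: "msmooth S J"
    and J_square: "\<And>x. x \<in> S \<Longrightarrow> J x ** J x = - mat 1"
    and J_orth: "\<And>x. x \<in> S \<Longrightarrow> transpose (J x) ** G x ** J x = G x"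
    and J_parallel: "\<And>x k i j. x \<in> S \<Longrightarrow> cov_deriv_endo G J x k i j = 0"
begin

lemma G_sym: "x \<in> S \<Longrightarrow> G x $ i $ j = G x $ j $ i"
  using sym_G[of x] by (metis transpose_def vec_lambda_beta)

lemma invertible_G:
  assumes "x \<in> S"
  shows "invertible (G x)"
proof -
  have "v = 0" if "G x *v v = 0" for v
    using pos_G[OF assms, of v] that by force
  then show ?thesis
    using invertible_left_inverse matrix_left_invertible_ker by blast
qed

lemma dG_sym: "x \<in> S \<Longrightarrow> partial_deriv l (\<lambda>y. G y $ i $ j) x = partial_deriv l (\<lambda>y. G y $ j $ i) x"
  by (rule partial_deriv_cong_open[OF open_S]) (auto intro: G_sym)

lemma christoffel_sym:
  assumes "x \<in> S"
  shows "christoffel G x k i j = christoffel G x k j i"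
  unfolding christoffel_def by (simp add: dG_sym[OF assms, of _ i j] add.commute)

lemma mdiff_conn:
  assumes "x \<in> S"
  shows "mdiff (conn_matrix G i) x"
proof -
  have dG: "(\<lambda>y. partial_deriv k (\<lambda>y. G y $ a $ b) y) differentiable (at x)" for k a b
    using smooth_G assms unfolding msmooth_def
    by (auto intro: smooth_on_differentiable smooth_on_partial_deriv)
  have inv: "(\<lambda>y. matrix_inv (G y) $ k $ l) differentiable (at x)" for k l
    by (rule differentiable_matrix_inv[OF open_S assms invertible_G])
       (auto intro: msmooth_mdiff smooth_G assms)
  show ?thesis
    unfolding mdiff_def conn_matrix_def christoffel_def vec_lambda_beta divide_inverse
    by (intro allI differentiable_mult differentiable_sum ballI differentiable_add differentiable_diff
        differentiable_const finite dG inv)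
qed

lemma lowered_christoffel:
  assumes "x \<in> S"
  shows "(\<Sum>a\<in>UNIV. G x $ k $ a * christoffel G x a i j) =
    (partial_deriv i (\<lambda>y. G y $ j $ k) x + partial_deriv j (\<lambda>y. G y $ i $ k) x
       - partial_deriv k (\<lambda>y. G y $ i $ j) x) / 2"
proof -
  define c where "c = (\<chi> l. (partial_deriv i (\<lambda>y. G y $ j $ l) x + partial_deriv j (\<lambda>y. G y $ i $ l) x
       - partial_deriv l (\<lambda>y. G y $ i $ j) x) / 2)"
  have "christoffel G x a i j = (matrix_inv (G x) *v c) $ a" for a
    by (simp add: christoffel_def c_def matrix_vector_mult_def sum_divide_distrib)
  then have "(\<Sum>a\<in>UNIV. G x $ k $ a * christoffel G x a i j) = (G x *v (matrix_inv (G x) *v c)) $ k"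
    by (simp add: matrix_vector_mult_def)
  also have "\<dots> = c $ k"
    by (simp add: matrix_vector_mul_assoc invertible_matrix_inv invertible_G[OF assms])
  finally show ?thesis by (simp add: c_def)
qed

text \<open>This is \<open>\<nabla>g = 0\<close>: the two Christoffel symbols with a lowered index add up to a single derivative
  of the metric.\<close>

lemma metric_compatible:
  assumes "x \<in> S"
  shows "mpartial i G x = transpose (conn_matrix G i x) ** G x + G x ** conn_matrix G i x"
proof -
  have "partial_deriv i (\<lambda>y. G y $ j $ k) x =
      (\<Sum>a\<in>UNIV. christoffel G x a i j * G x $ a $ k) + (\<Sum>a\<in>UNIV. G x $ j $ a * christoffel G x a i k)"
    for j k
  proof -
    have "(\<Sum>a\<in>UNIV. christoffel G x a i j * G x $ a $ k) = (\<Sum>a\<in>UNIV. G x $ k $ a * christoffel G x a i j)"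
      by (simp add: G_sym[OF assms, of k] mult.commute)
    then show ?thesis
      unfolding lowered_christoffel[OF assms]
      by (simp add: lowered_christoffel[OF assms] dG_sym[OF assms, of _ k] field_simps)
  qed
  then show ?thesis
    by (simp add: vec_eq_iff mpartial_def matrix_matrix_mult_def transpose_def conn_matrix_def)
qed

lemma J_commutator:
  assumes "x \<in> S"
  shows "mpartial i J x = J x ** conn_matrix G i x - conn_matrix G i x ** J x"
proof -
  have "partial_deriv i (\<lambda>y. J y $ a $ b) x =
    (\<Sum>l\<in>UNIV. J x $ a $ l * christoffel G x l i b) - (\<Sum>l\<in>UNIV. christoffel G x a i l * J x $ l $ b)" for a b
    using J_parallel[OF assms, of i a b] by (simp add: cov_deriv_endo_def mult.commute)
  then show ?thesis
    by (simp add: vec_eq_iff mpartial_def matrix_matrix_mult_def conn_matrix_def)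
qed

lemma mdiff_G: "x \<in> S \<Longrightarrow> mdiff G x" and mdiff_J: "x \<in> S \<Longrightarrow> mdiff J x"
  using msmooth_mdiff smooth_G smooth_J by blast+

text \<open>Differentiating \<open>\<partial>\<^sub>j G = \<Gamma>\<^sub>j\<^sup>T G + G \<Gamma>\<^sub>j\<close> once more and antisymmetrizing, the left-hand side
  vanishes because partial derivatives commute, and the right-hand side collects the curvature.\<close>

lemma curvature_skew:
  assumes "x \<in> S"
  shows "transpose (curv_matrix G x i j) ** G x + G x ** curv_matrix G x i j = 0"
proof -
  let ?\<Gamma> = "\<lambda>i. conn_matrix G i x"
  note d = mdiff_G[OF assms] mdiff_conn[OF assms] mdiff_transpose
  have "mpartial k (mpartial l G) x
      = transpose (mpartial k (conn_matrix G l) x) ** G x + G x ** mpartial k (conn_matrix G l) x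
        + transpose (?\<Gamma> l) ** (transpose (?\<Gamma> k) ** G x + G x ** ?\<Gamma> k)
        + (transpose (?\<Gamma> k) ** G x + G x ** ?\<Gamma> k) ** ?\<Gamma> l" for k l
  proof -
    have "mpartial k (mpartial l G) x
      = mpartial k (\<lambda>y. transpose (conn_matrix G l y) ** G y + G y ** conn_matrix G l y) x"
      by (rule mpartial_cong_open[OF open_S assms]) (rule metric_compatible)
    also have "\<dots> = mpartial k (\<lambda>y. transpose (conn_matrix G l y)) x ** G x
          + transpose (?\<Gamma> l) ** mpartial k G x + (mpartial k G x ** ?\<Gamma> l + G x ** mpartial k (conn_matrix G l) x)"
      by (simp add: mpartial_add mpartial_mult d)
    finally show ?thesis
      by (simp add: mpartial_transpose metric_compatible[OF assms])
  qed
  note second = this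
  have "transpose (curv_matrix G x i j) ** G x + G x ** curv_matrix G x i j
      = mpartial i (mpartial j G) x - mpartial j (mpartial i G) x"
    unfolding second
    by (simp add: curv_matrix_eq transpose_add transpose_diff matrix_distribs matrix_mul_assoc
        matrix_transpose_mul)
  then show ?thesis
    using mpartial_commute[OF open_S assms smooth_G, of i j] by simp
qed

text \<open>The same argument applied to the equation \<open>\<partial>\<^sub>j J = J \<Gamma>\<^sub>j - \<Gamma>\<^sub>j J\<close>, which says that \<open>J\<close> is parallel.\<close>

lemma curvature_commutes_J:
  assumes "x \<in> S"
  shows "curv_matrix G x i j ** J x = J x ** curv_matrix G x i j"
proof -
  let ?\<Gamma> = "\<lambda>i. conn_matrix G i x"
  note d = mdiff_J[OF assms] mdiff_conn[OF assms]
  have "mpartial k (mpartial l J) x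
      = (J x ** ?\<Gamma> k - ?\<Gamma> k ** J x) ** ?\<Gamma> l + J x ** mpartial k (conn_matrix G l) x
        - (mpartial k (conn_matrix G l) x ** J x + ?\<Gamma> l ** (J x ** ?\<Gamma> k - ?\<Gamma> k ** J x))" for k l
  proof -
    have "mpartial k (mpartial l J) x = mpartial k (\<lambda>y. J y ** conn_matrix G l y - conn_matrix G l y ** J y) x"
      by (rule mpartial_cong_open[OF open_S assms]) (rule J_commutator)
    also have "\<dots> = mpartial k J x ** ?\<Gamma> l + J x ** mpartial k (conn_matrix G l) x
        - (mpartial k (conn_matrix G l) x ** J x + ?\<Gamma> l ** mpartial k J x)"
      by (simp add: mpartial_diff mpartial_mult d)
    finally show ?thesis
      by (simp add: J_commutator[OF assms])
  qed
  note second = this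
  have "curv_matrix G x i j ** J x - J x ** curv_matrix G x i j
      = mpartial j (mpartial i J) x - mpartial i (mpartial j J) x"
    unfolding second by (simp add: curv_matrix_eq matrix_distribs matrix_mul_assoc)
  then show ?thesis
    using mpartial_commute[OF open_S assms smooth_J, of i j] by simp
qed

lemma curvature_comp_bianchi:
  assumes "x \<in> S"
  shows "curvature_comp G x i j l a + curvature_comp G x j l i a + curvature_comp G x l i j a = 0"
proof -
  have "partial_deriv k (\<lambda>y. christoffel G y a p q) x = partial_deriv k (\<lambda>y. christoffel G y a q p) x" for k p q
    by (rule partial_deriv_cong_open[OF open_S assms]) (rule christoffel_sym)
  note * = this[of _ j i] this[of _ l i] this[of _ l j]
  note ** = christoffel_sym[OF assms, of _ j i] christoffel_sym[OF assms, of _ l i] christoffel_sym[OF assms, of _ l j]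
  show ?thesis
    unfolding curvature_comp_def * ** by (simp add: sum_subtractf)
qed

lemma linear_Rm:
  "linear (\<lambda>u. Rm G x u v w z)" "linear (\<lambda>v. Rm G x u v w z)"
  "linear (\<lambda>w. Rm G x u v w z)" "linear (\<lambda>z. Rm G x u v w z)"
  unfolding Rm_eq_curv_matrix
  by (intro linear_compose_sum linearI ballI;
      simp add: algebra_simps inner_add_left inner_add_right matrix_vector_right_distrib
        matrix_vector_mult_scaleR)+

lemma Rm_antisym_left: "Rm G x v u w z = - Rm G x u v w z"
proof -
  let ?c = "\<lambda>i j. w \<bullet> (G x *v (curv_matrix G x i j *v z))"
  have c: "?c j i = - ?c i j" for i j
    by (subst curv_matrix_antisym) (simp add: uminus_matrix_vector_mult matrix_vector_mult_uminus)
  have "Rm G x v u w z = (\<Sum>j\<in>UNIV. \<Sum>i\<in>UNIV. v $ i * u $ j * ?c i j)"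
    unfolding Rm_eq_curv_matrix by (rule sum.swap)
  also have "\<dots> = (\<Sum>j\<in>UNIV. \<Sum>i\<in>UNIV. - (u $ j * v $ i * ?c j i))"
  proof (intro sum.cong refl)
    fix i j
    show "v $ i * u $ j * ?c i j = - (u $ j * v $ i * ?c j i)"
      unfolding c[of j i] by simp
  qed
  finally show ?thesis
    by (simp add: Rm_eq_curv_matrix sum_negf)
qed

lemma Rm_antisym_right:
  assumes "x \<in> S"
  shows "Rm G x u v z w = - Rm G x u v w z"
proof -
  have "z \<bullet> (G x *v (curv_matrix G x i j *v w)) = - (w \<bullet> (G x *v (curv_matrix G x i j *v z)))" for i j
  proof -
    let ?K = "curv_matrix G x i j"
    have "G x ** ?K = - (transpose ?K ** G x)"
      using curvature_skew[OF assms, of i j] by (simp add: eq_neg_iff_add_eq_0 add.commute)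
    then have "z \<bullet> (G x *v (?K *v w)) = - (z \<bullet> ((transpose ?K ** G x) *v w))"
      by (simp add: matrix_vector_mul_assoc uminus_matrix_vector_mult)
    also have "(transpose ?K ** G x) = transpose (G x ** ?K)"
      by (simp add: matrix_transpose_mul sym_G[OF assms])
    also have "z \<bullet> (transpose (G x ** ?K) *v w) = w \<bullet> ((G x ** ?K) *v z)"
      by (metis dot_lmul_matrix inner_commute transpose_matrix_vector)
    finally show ?thesis by (simp add: matrix_vector_mul_assoc)
  qed
  then show ?thesis
    by (simp add: Rm_eq_curv_matrix sum_negf)
qed

lemma Rm_bianchi:
  assumes "x \<in> S"
  shows "Rm G x u v w z + Rm G x v z w u + Rm G x z u w v = 0"
proof -
  define c where "c i j l = w \<bullet> (G x *v (\<chi> a. curvature_comp G x i j l a))" for i j l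
  have cyc: "c i j l + c j l i + c l i j = 0" for i j l
  proof -
    have "(\<chi> a. curvature_comp G x i j l a) + (\<chi> a. curvature_comp G x j l i a)
        + (\<chi> a. curvature_comp G x l i j a) = 0"
      by (simp add: vec_eq_iff curvature_comp_bianchi[OF assms])
    then have "w \<bullet> (G x *v ((\<chi> a. curvature_comp G x i j l a) + (\<chi> a. curvature_comp G x j l i a)
        + (\<chi> a. curvature_comp G x l i j a))) = 0"
      by simp
    then show ?thesis
      by (simp add: c_def matrix_vector_right_distrib inner_add_right)
  qed
  have Rm: "Rm G x u v w z = (\<Sum>i\<in>UNIV. \<Sum>j\<in>UNIV. \<Sum>l\<in>UNIV. u $ i * v $ j * z $ l * c i j l)" for u v z
  proof -
    have "w \<bullet> (G x *v (curv_matrix G x i j *v z)) = (\<Sum>l\<in>UNIV. z $ l * c i j l)" for i j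
    proof -
      have "curv_matrix G x i j *v z = (\<Sum>l\<in>UNIV. z $ l *\<^sub>R (\<chi> a. curvature_comp G x i j l a))"
        by (simp add: vec_eq_iff matrix_vector_mult_def curv_matrix_def mult.commute)
      then show ?thesis
        by (simp add: c_def linear_sum[OF matrix_vector_mul_linear] inner_sum_right matrix_vector_mult_scaleR)
    qed
    then show ?thesis
      by (simp add: Rm_eq_curv_matrix sum_distrib_left mult.assoc)
  qed
  have rotate: "(\<Sum>i\<in>UNIV. \<Sum>j\<in>UNIV. \<Sum>l\<in>UNIV. f i j l) = (\<Sum>l\<in>UNIV. \<Sum>i\<in>UNIV. \<Sum>j\<in>UNIV. f i j l)"
    for f :: "'n \<Rightarrow> 'n \<Rightarrow> 'n \<Rightarrow> real"
  proof -
    have "(\<Sum>i\<in>UNIV. \<Sum>j\<in>UNIV. \<Sum>l\<in>UNIV. f i j l) = (\<Sum>i\<in>UNIV. \<Sum>l\<in>UNIV. \<Sum>j\<in>UNIV. f i j l)"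
      by (rule sum.cong[OF refl], rule sum.swap)
    also have "\<dots> = (\<Sum>l\<in>UNIV. \<Sum>i\<in>UNIV. \<Sum>j\<in>UNIV. f i j l)"
      by (rule sum.swap)
    finally show ?thesis .
  qed
  have "Rm G x v z w u = (\<Sum>i\<in>UNIV. \<Sum>j\<in>UNIV. \<Sum>l\<in>UNIV. u $ i * v $ j * z $ l * c j l i)"
    unfolding Rm by (subst rotate) (simp add: mult_ac)
  moreover have "Rm G x z u w v = (\<Sum>i\<in>UNIV. \<Sum>j\<in>UNIV. \<Sum>l\<in>UNIV. u $ i * v $ j * z $ l * c l i j)"
    unfolding Rm by (subst rotate, subst rotate) (simp add: mult_ac)
  ultimately have "Rm G x u v w z + Rm G x v z w u + Rm G x z u w v
      = (\<Sum>i\<in>UNIV. \<Sum>j\<in>UNIV. \<Sum>l\<in>UNIV. u $ i * v $ j * z $ l * (c i j l + c j l i + c l i j))"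
    by (simp only: Rm[of u v z] distrib_left sum.distrib)
  then show ?thesis
    by (simp add: cyc)
qed

lemma Rm_J_invariant:
  assumes "x \<in> S"
  shows "Rm G x u v (J x *v w) (J x *v z) = Rm G x u v w z"
proof -
  have "(J x *v w) \<bullet> (G x *v (K *v (J x *v z))) = w \<bullet> (G x *v (K *v z))"
    if "K ** J x = J x ** K" for K
  proof -
    have "(J x *v w) \<bullet> (G x *v (K *v (J x *v z))) = w \<bullet> (transpose (J x) *v (G x *v (K *v (J x *v z))))"
      by (metis dot_lmul_matrix inner_commute transpose_matrix_vector)
    also have "\<dots> = w \<bullet> ((transpose (J x) ** G x ** (K ** J x)) *v z)"
      by (simp add: matrix_vector_mul_assoc matrix_mul_assoc del: transpose_matrix_vector)
    also have "\<dots> = w \<bullet> ((transpose (J x) ** G x ** J x ** K) *v z)"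
      by (simp add: that matrix_mul_assoc)
    finally show ?thesis
      by (simp add: J_orth[OF assms] matrix_vector_mul_assoc)
  qed
  then show ?thesis
    using curvature_commutes_J[OF assms] by (simp add: Rm_eq_curv_matrix)
qed

end


section \<open>Algebraic Kaehler curvature tensors\<close>

lemma sum_indicator2:
  fixes f :: "'a::finite \<Rightarrow> 'b::finite \<Rightarrow> real"
  shows "(\<Sum>k\<in>UNIV. \<Sum>l\<in>UNIV. f k l * (if k = p \<and> l = q then 1 else 0)) = f p q"
proof -
  have "(\<Sum>l\<in>UNIV. f k l * (if k = p \<and> l = q then 1 else 0)) = (if k = p then f k q else 0)" for k
    by (cases "k = p") (auto simp: if_distrib cong: if_cong)
  then show ?thesis by simp
qed

text \<open>Components of the curvature tensor and of the complex structure in an orthonormal frame. The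
  condition \<open>M\<^sup>2 = -1\<close> is encoded by skewness and orthogonality. The invariance under \<open>J\<close> is
  required in the last two slots, where it reads \<open>M\<^sup>T N M = N\<close> for the matrix \<open>N\<close> of
  components with the first two indices fixed.\<close>

locale kaehler_tensor =
  fixes R :: "'n::finite \<Rightarrow> 'n \<Rightarrow> 'n \<Rightarrow> 'n \<Rightarrow> real" and M :: "real^'n^'n"
  assumes antisym_left: "R j i k l = - R i j k l"
    and antisym_right: "R i j l k = - R i j k l"
    and bianchi: "R i j k l + R j l k i + R l i k j = 0"
    and M_skew: "transpose M = - M"
    and M_orth: "transpose M ** M = mat 1"
    and J_invariant: "transpose M ** (\<chi> k l. R i j k l) ** M = (\<chi> k l. R i j k l)"
begin

text \<open>The classical octahedron argument: the alternating combination of the four Bianchi identities for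
  \<open>i, j, k, l\<close>.\<close>

lemma pair_sym: "R k l i j = R i j k l"
  using bianchi[of i j k l] bianchi[of j k l i] bianchi[of k l i j] bianchi[of l i j k]
    antisym_left[of i j] antisym_left[of i k] antisym_left[of i l] antisym_left[of j k]
    antisym_left[of j l] antisym_left[of k l]
    antisym_right[of _ _ i j] antisym_right[of _ _ i k] antisym_right[of _ _ i l] antisym_right[of _ _ j k]
    antisym_right[of _ _ j l] antisym_right[of _ _ k l]
  by (smt (verit))

lemma bianchi_right: "R i j k l + R i k l j + R i l j k = 0"
proof -
  have "R j k i l + R k l i j + R l j i k = 0"
    using bianchi by blast
  moreover have "R j k i l = R i l j k" "R k l i j = R i j k l" "R l j i k = R i k l j"
    using pair_sym by blast+
  ultimately show ?thesis by simp
qed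

lemma diag_zero: "R i i k l = 0" "R i j k k = 0"
  using antisym_left[of i i k l] antisym_right[of i j k k] by auto

lemma M_skew': "M $ i $ j = - M $ j $ i"
  using arg_cong[OF M_skew, of "\<lambda>P. P $ j $ i"] by (simp add: transpose_def)

lemma M_orth': "M ** transpose M = mat 1"
  using M_orth matrix_left_right_inverse by blast

definition scalar_curv :: real where
  "scalar_curv = (\<Sum>i\<in>UNIV. \<Sum>j\<in>UNIV. R i j i j)"

lemma scalar_curv_neg: "(\<Sum>i\<in>UNIV. \<Sum>j\<in>UNIV. R i j j i) = - scalar_curv"
proof -
  have "(\<Sum>i\<in>UNIV. \<Sum>j\<in>UNIV. R i j j i) = (\<Sum>i\<in>UNIV. \<Sum>j\<in>UNIV. - R i j i j)"
    by (intro sum.cong refl antisym_right)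
  then show ?thesis by (simp add: scalar_curv_def sum_negf)
qed

text \<open>For fixed \<open>i\<close> and \<open>j\<close> the inner sum is an entry of \<open>M\<^sup>T N M\<^sup>T\<close>, where \<open>N = M\<^sup>T N M\<close>; the four
  factors \<open>M\<close> cancel up to the sign of \<open>M\<^sup>T M\<^sup>T = -1\<close>.\<close>

lemma J_contraction:
  "(\<Sum>i\<in>UNIV. \<Sum>j\<in>UNIV. \<Sum>k\<in>UNIV. \<Sum>l\<in>UNIV. R i j k l * M $ k $ i * M $ j $ l) = - scalar_curv"
proof -
  have "(\<Sum>k\<in>UNIV. \<Sum>l\<in>UNIV. R i j k l * M $ k $ i * M $ j $ l) = - R i j i j" for i j
  proof -
    let ?N = "(\<chi> k l. R i j k l) :: real^'n^'n"
    have "(\<Sum>k\<in>UNIV. \<Sum>l\<in>UNIV. R i j k l * M $ k $ i * M $ j $ l) = (transpose M ** (?N ** transpose M)) $ i $ j"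
      by (simp add: matrix_matrix_mult_def transpose_def sum_distrib_left mult_ac)
    also have "?N ** transpose M = transpose M ** ?N ** (M ** transpose M)"
      using J_invariant[of i j] by (simp add: matrix_mul_assoc)
    also have "transpose M ** (transpose M ** ?N ** (M ** transpose M)) = (transpose M ** transpose M) ** ?N"
      by (simp add: M_orth' matrix_mul_assoc)
    also have "transpose M ** transpose M = - mat 1"
    proof -
      have "transpose M ** transpose M = - (transpose M ** M)"
        by (subst (2) M_skew) (simp add: vec_eq_iff matrix_matrix_mult_def sum_negf)
      then show ?thesis by (simp add: M_orth)
    qed
    also have "- mat 1 ** ?N = - ?N"
    proof -
      have "- mat 1 ** ?N = - (mat 1 ** ?N)"
        by (simp only: vec_eq_iff matrix_matrix_mult_def) (simp add: sum_negf)
      then show ?thesis by simp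
    qed
    finally show ?thesis by simp
  qed
  then show ?thesis
    by (simp add: scalar_curv_def sum_negf)
qed

text \<open>The first Bianchi identity writes the summand as a difference of two terms. Each of them
  contributes one copy of the previous contraction, since \<open>M\<close> is skew.\<close>

lemma J_contraction':
  "(\<Sum>i\<in>UNIV. \<Sum>k\<in>UNIV. \<Sum>j\<in>UNIV. \<Sum>l\<in>UNIV. R i k j l * M $ k $ i * M $ j $ l) = - 2 * scalar_curv"
proof -
  let ?Y = "\<Sum>i\<in>UNIV. \<Sum>k\<in>UNIV. \<Sum>j\<in>UNIV. \<Sum>l\<in>UNIV. R i j k l * M $ k $ i * M $ j $ l"
  have Y: "?Y = - scalar_curv"
    unfolding J_contraction[symmetric] by (rule sum.cong[OF refl], rule sum.swap)
  have split: "R i k j l * M $ k $ i * M $ j $ l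
      = R i j k l * M $ k $ i * M $ j $ l - R i l k j * M $ k $ i * M $ j $ l" for i j k l
  proof -
    have "R i k j l = R i j k l - R i l k j"
      using bianchi_right[of i k j l] antisym_right[of i j l k] antisym_right[of i l k j] by linarith
    then show ?thesis by (simp add: left_diff_distrib)
  qed
  have "(\<Sum>i\<in>UNIV. \<Sum>k\<in>UNIV. \<Sum>j\<in>UNIV. \<Sum>l\<in>UNIV. R i k j l * M $ k $ i * M $ j $ l)
     = (\<Sum>i\<in>UNIV. \<Sum>k\<in>UNIV. \<Sum>j\<in>UNIV. \<Sum>l\<in>UNIV.
         R i j k l * M $ k $ i * M $ j $ l - R i l k j * M $ k $ i * M $ j $ l)"
    by (intro sum.cong refl) (rule split)
  then have "(\<Sum>i\<in>UNIV. \<Sum>k\<in>UNIV. \<Sum>j\<in>UNIV. \<Sum>l\<in>UNIV. R i k j l * M $ k $ i * M $ j $ l)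
     = ?Y - (\<Sum>i\<in>UNIV. \<Sum>k\<in>UNIV. \<Sum>j\<in>UNIV. \<Sum>l\<in>UNIV. R i l k j * M $ k $ i * M $ j $ l)"
    by (simp only: sum_subtractf)
  also have "(\<Sum>i\<in>UNIV. \<Sum>k\<in>UNIV. \<Sum>j\<in>UNIV. \<Sum>l\<in>UNIV. R i l k j * M $ k $ i * M $ j $ l)
     = (\<Sum>i\<in>UNIV. \<Sum>k\<in>UNIV. \<Sum>j\<in>UNIV. \<Sum>l\<in>UNIV. - (R i j k l * M $ k $ i * M $ j $ l))"
  proof (rule sum.cong[OF refl], rule sum.cong[OF refl])
    fix i k
    have "(\<Sum>j\<in>UNIV. \<Sum>l\<in>UNIV. R i l k j * M $ k $ i * M $ j $ l)
        = (\<Sum>j\<in>UNIV. \<Sum>l\<in>UNIV. R i j k l * M $ k $ i * M $ l $ j)"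
      by (rule sum.swap)
    also have "\<dots> = (\<Sum>j\<in>UNIV. \<Sum>l\<in>UNIV. - (R i j k l * M $ k $ i * M $ j $ l))"
    proof (intro sum.cong refl)
      fix j l
      show "R i j k l * M $ k $ i * M $ l $ j = - (R i j k l * M $ k $ i * M $ j $ l)"
        unfolding M_skew'[of l j] by simp
    qed
    finally show "(\<Sum>j\<in>UNIV. \<Sum>l\<in>UNIV. R i l k j * M $ k $ i * M $ j $ l)
      = (\<Sum>j\<in>UNIV. \<Sum>l\<in>UNIV. - (R i j k l * M $ k $ i * M $ j $ l))" .
  qed
  finally show ?thesis
    by (simp add: sum_negf Y)
qed

text \<open>The projection onto trace-free matrices changes only the diagonal, so all off-diagonal entries of
  \<open>R_bar R h\<close> vanish. Testing with \<open>E\<^sub>p\<^sub>q + E\<^sub>q\<^sub>p\<close> and with \<open>E\<^sub>a\<^sub>a - E\<^sub>p\<^sub>p\<close> shows that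
  \<open>R a p q b\<close> is skew in \<open>p, q\<close> whenever \<open>a \<noteq> b\<close>. It is then invariant under cyclic permutations
  of the last three indices, and the Bianchi identity makes it zero. Components with equal outer
  indices reduce to this case by antisymmetry.\<close>

lemma curv_op2_zero_imp_zero:
  assumes "\<And>h. h \<in> S20 \<Longrightarrow> curv_op2 R h = 0"
  shows "R i j k l = 0"
proof -
  have off: "R_bar R h $ a $ b = 0" if "h \<in> S20" "a \<noteq> b" for h a b
    using assms[OF that(1)] that(2) by (simp add: curv_op2_def pr_S20_def vec_eq_iff mat_def)
  have ne: "R a p q b + R a q p b = 0" if "a \<noteq> b" "p \<noteq> q" for a b p q
  proof -
    define h :: "real^'n^'n" where "h = (\<chi> i j. (if i = p \<and> j = q then 1 else 0) + (if i = q \<and> j = p then 1 else 0))"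
    have "h \<in> S20"
      using that by (auto simp: S20_def h_def transpose_def trace_def vec_eq_iff intro!: sum.neutral)
    from off[OF this that(1)] show ?thesis
      by (simp only: R_bar_def h_def vec_lambda_beta distrib_left sum.distrib sum_indicator2)
  qed
  have eq: "R a p p b = 0" if "a \<noteq> b" for a b p
  proof (cases "p = a")
    case False
    define h :: "real^'n^'n" where "h = (\<chi> i j. (if i = a \<and> j = a then 1 else 0) - (if i = p \<and> j = p then 1 else 0))"
    have "h \<in> S20"
      by (auto simp: S20_def h_def transpose_def trace_def vec_eq_iff sum_subtractf)
    from off[OF this that] show ?thesis
      by (simp only: R_bar_def h_def vec_lambda_beta right_diff_distrib sum_subtractf sum_indicator2 diag_zero)
  qed (simp add: diag_zero)
  have skew: "R a p q b = - R a q p b" if "a \<noteq> b" for a b p q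
    using ne[OF that] eq[OF that] by (cases "p = q") (auto simp: eq_neg_iff_add_eq_0)
  have cyc: "R a p q b = R a q b p" if "a \<noteq> b" for a b p q
    using skew[OF that, of p q] antisym_right[of a q b p] by simp
  have 1: "R a p q b = 0" if "a \<noteq> b" for a b p q
  proof (cases "a = p")
    case False
    then show ?thesis
      using cyc[OF that, of p q] cyc[OF False, of q b] bianchi_right[of a p q b] by simp
  qed (simp add: diag_zero)
  show ?thesis
  proof (cases "i = l")
    case True
    then show ?thesis
      using 1[of i k j l] antisym_right[of i j k l] 1[of i k j i] diag_zero by (cases "i = k") auto
  qed (rule 1)
qed

end


section \<open>Traces over the trace-free symmetric matrices\<close>

lemma inner_matrix_eq_trace: "(P :: real^'n^'n::finite) \<bullet> Q = trace (transpose P ** Q)"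
proof -
  have "P \<bullet> Q = (\<Sum>i\<in>UNIV. \<Sum>j\<in>UNIV. P $ i $ j * Q $ i $ j)"
    by (simp add: inner_vec_def)
  also have "\<dots> = (\<Sum>j\<in>UNIV. \<Sum>i\<in>UNIV. P $ i $ j * Q $ i $ j)"
    by (rule sum.swap)
  finally show ?thesis
    by (simp add: trace_def matrix_matrix_mult_def transpose_def)
qed

lemma subspace_S20: "subspace S20"
  by (auto simp: subspace_def S20_def transpose_def vec_eq_iff trace_def sum.distrib sum_distrib_left[symmetric])

lemma inner_mat_1: "(b :: real^'n^'n::finite) \<bullet> mat 1 = trace b"
  by (simp add: inner_vec_def mat_def trace_def if_distrib cong: if_cong)

lemma inner_pr_S20:
  assumes "trace b = 0"
  shows "b \<bullet> pr_S20 h = b \<bullet> h"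
  using assms by (simp add: pr_S20_def inner_diff_right inner_mat_1)

locale S20_basis =
  fixes B :: "(real^'n^'n::finite) set"
  assumes finite_B: "finite B"
    and orthonormal_B: "b \<in> B \<Longrightarrow> b' \<in> B \<Longrightarrow> b \<bullet> b' = (if b = b' then 1 else 0)"
    and span_B: "span B = S20"
begin

lemma B_S20: "b \<in> B \<Longrightarrow> b \<in> S20"
  using span_B span_base by blast

text \<open>The sum is the integral kernel of the orthogonal projection onto \<open>S20\<close>. That projection is
  also known in closed form (symmetrize, then remove the trace), which makes traces over \<open>S20\<close>
  independent of the basis and computable.\<close>

lemma entry_products_sum:
  "(\<Sum>b\<in>B. b $ p $ q * b $ k $ l) =
     ((if k = p \<and> l = q then 1 else 0) + (if k = q \<and> l = p then 1 else 0)) / 2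
     - (if p = q \<and> k = l then 1 else 0) / real CARD('n)"
proof -
  define E :: "real^'n^'n" where "E = (\<chi> i j. if i = p \<and> j = q then 1 else 0)"
  define P where "P = (\<Sum>b\<in>B. (b \<bullet> E) *\<^sub>R b)"
  define Q where "Q = pr_S20 ((1/2) *\<^sub>R (E + transpose E))"
  have bE: "b \<bullet> E = b $ p $ q" for b
    by (simp only: E_def inner_vec_def inner_real_def vec_lambda_beta sum_indicator2)
  have bE': "b \<bullet> transpose E = b $ q $ p" for b
    proof -
    have "b \<bullet> transpose E = (\<Sum>i\<in>UNIV. \<Sum>j\<in>UNIV. b $ i $ j * (if i = q \<and> j = p then 1 else 0))"
      unfolding inner_vec_def by (intro sum.cong refl) (auto simp: E_def transpose_def)
    then show ?thesis by (simp only: sum_indicator2)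
  qed
  have "Q \<in> S20"
    unfolding Q_def
    by (rule pr_S20_orthogonal_projection) (simp add: vec_eq_iff transpose_def add.commute)
  moreover have "P \<in> S20"
    unfolding P_def by (intro subspace_sum subspace_scale subspace_S20 B_S20)
  ultimately have "P - Q \<in> span B"
    unfolding span_B by (intro subspace_diff subspace_S20)
  moreover have "b \<bullet> (P - Q) = 0" if "b \<in> B" for b
  proof -
    have "trace b = 0" "b $ q $ p = b $ p $ q"
      using B_S20[OF that] by (auto simp: S20_def transpose_def vec_eq_iff)
    then have "b \<bullet> Q = b $ p $ q"
      by (simp add: Q_def inner_pr_S20 inner_add_right bE bE')
    moreover have "b \<bullet> P = b $ p $ q"
      using that finite_B by (simp add: P_def inner_sum_right orthonormal_B if_distrib bE cong: if_cong)
    ultimately show ?thesis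
      by (simp add: inner_diff_right)
  qed
  ultimately have "(P - Q) \<bullet> (P - Q) = 0"
    by (metis (no_types, lifting) inner_commute orthogonal_def orthogonal_to_span)
  then have "P $ k $ l = Q $ k $ l" by simp
  moreover have "P $ k $ l = (\<Sum>b\<in>B. b $ p $ q * b $ k $ l)"
    by (simp add: P_def bE)
  moreover have "trace E = (if p = q then 1 else 0)" "trace (transpose E) = (if p = q then 1 else 0)"
    by (auto simp: trace_def E_def transpose_def intro!: sum.neutral)
  then have "Q $ k $ l = ((if k = p \<and> l = q then 1 else 0) + (if k = q \<and> l = p then 1 else 0)) / 2
     - (if p = q \<and> k = l then 1 else 0) / real CARD('n)"
    by (auto simp: Q_def pr_S20_def E_def transpose_def mat_def trace_def)
  ultimately show ?thesis by simp
qed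

lemma quadratic_form_trace:
  fixes c :: "'n \<Rightarrow> 'n \<Rightarrow> 'n \<Rightarrow> 'n \<Rightarrow> real"
  shows "(\<Sum>b\<in>B. \<Sum>i\<in>UNIV. \<Sum>j\<in>UNIV. \<Sum>k\<in>UNIV. \<Sum>l\<in>UNIV. c i j k l * (b $ i $ j * b $ k $ l)) =
     ((\<Sum>i\<in>UNIV. \<Sum>j\<in>UNIV. c i j i j) + (\<Sum>i\<in>UNIV. \<Sum>j\<in>UNIV. c i j j i)) / 2
     - (\<Sum>i\<in>UNIV. \<Sum>k\<in>UNIV. c i i k k) / real CARD('n)"
proof -
  have "(\<Sum>b\<in>B. \<Sum>i\<in>UNIV. \<Sum>j\<in>UNIV. \<Sum>k\<in>UNIV. \<Sum>l\<in>UNIV. c i j k l * (b $ i $ j * b $ k $ l))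
     = (\<Sum>i\<in>UNIV. \<Sum>j\<in>UNIV. \<Sum>k\<in>UNIV. \<Sum>l\<in>UNIV. c i j k l * (\<Sum>b\<in>B. b $ i $ j * b $ k $ l))"
    by (simp add: sum_distrib_left sum.swap[of _ UNIV B])
  also have "\<dots> = (\<Sum>i\<in>UNIV. \<Sum>j\<in>UNIV. \<Sum>k\<in>UNIV. \<Sum>l\<in>UNIV.
      c i j k l / 2 * (if k = i \<and> l = j then 1 else 0) + c i j k l / 2 * (if k = j \<and> l = i then 1 else 0)
      - c i j k l / real CARD('n) * (if i = j \<and> k = l then 1 else 0))"
  proof -
    have "t * ((x + y) / 2 - z / N) = t / 2 * x + t / 2 * y - t / N * z" for t x y z N :: real
      by (simp add: right_diff_distrib distrib_left add_divide_distrib)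
    then show ?thesis
      unfolding entry_products_sum by (simp only:)
  qed
  also have "\<dots> = (\<Sum>i\<in>UNIV. \<Sum>j\<in>UNIV. c i j i j / 2) + (\<Sum>i\<in>UNIV. \<Sum>j\<in>UNIV. c i j j i / 2)
      - (\<Sum>i\<in>UNIV. \<Sum>k\<in>UNIV. c i i k k / real CARD('n))"
  proof -
    have "(\<Sum>k\<in>UNIV. \<Sum>l\<in>UNIV. c i j k l / real CARD('n) * (if i = j \<and> k = l then 1 else 0))
         = (if i = j then \<Sum>k\<in>UNIV. c i i k k / real CARD('n) else 0)" for i j
      by (cases "i = j") (auto simp: if_distrib[of "\<lambda>t. _ * t"] cong: if_cong)
    then show ?thesis
      by (simp only: sum.distrib sum_subtractf sum_indicator2) simp
  qed
  finally show ?thesis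
    by (simp add: sum_divide_distrib add_divide_distrib)
qed

end

lemma sum_swap_pairs:
  "(\<Sum>i\<in>A. \<Sum>j\<in>B. \<Sum>k\<in>C. \<Sum>l\<in>D. f i j k l) = (\<Sum>k\<in>C. \<Sum>l\<in>D. \<Sum>i\<in>A. \<Sum>j\<in>B. f i j k l)"
proof -
  have "(\<Sum>i\<in>A. \<Sum>j\<in>B. \<Sum>k\<in>C. \<Sum>l\<in>D. f i j k l) = (\<Sum>i\<in>A. \<Sum>k\<in>C. \<Sum>j\<in>B. \<Sum>l\<in>D. f i j k l)"
    by (rule sum.cong[OF refl], rule sum.swap)
  also have "\<dots> = (\<Sum>k\<in>C. \<Sum>i\<in>A. \<Sum>l\<in>D. \<Sum>j\<in>B. f i j k l)"
    by (subst sum.swap) (rule sum.cong[OF refl], rule sum.cong[OF refl], rule sum.swap)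
  also have "\<dots> = (\<Sum>k\<in>C. \<Sum>l\<in>D. \<Sum>i\<in>A. \<Sum>j\<in>B. f i j k l)"
    by (rule sum.cong[OF refl], rule sum.swap)
  finally show ?thesis .
qed

context kaehler_tensor
begin

text \<open>The tensor \<open>h(J\<cdot>, J\<cdot>)\<close>. On symmetric matrices this involution is \<open>1\<close> on the \<open>J\<close>-invariant ones
  and \<open>-1\<close> on the \<open>J\<close>-anti-invariant ones.\<close>

abbreviation J_conj :: "real^'n^'n \<Rightarrow> real^'n^'n" where
  "J_conj h \<equiv> transpose M ** h ** M"

lemma J_conj_entry: "J_conj h $ i $ j = (\<Sum>p\<in>UNIV. \<Sum>q\<in>UNIV. M $ p $ i * M $ q $ j * h $ p $ q)"
proof -
  have "J_conj h $ i $ j = (\<Sum>q\<in>UNIV. \<Sum>p\<in>UNIV. M $ p $ i * M $ q $ j * h $ p $ q)"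
    by (simp add: matrix_matrix_mult_def transpose_def sum_distrib_left mult_ac)
  then show ?thesis by (subst sum.swap)
qed

lemma trace_J_conj: "trace (J_conj h) = trace h"
proof -
  have "trace (J_conj h) = trace (M ** (transpose M ** h))"
    by (rule trace_mul_sym)
  then show ?thesis by (simp add: matrix_mul_assoc M_orth')
qed

lemma inner_J_conj_J_conj: "J_conj h \<bullet> J_conj h = h \<bullet> h"
proof -
  have "transpose (J_conj h) ** J_conj h = (transpose M ** (transpose h ** h)) ** M"
  proof -
    have "transpose (J_conj h) ** J_conj h = transpose M ** transpose h ** (M ** transpose M) ** h ** M"
      by (simp only: matrix_transpose_mul transpose_transpose matrix_mul_assoc)
    then show ?thesis by (simp add: M_orth' matrix_mul_assoc)
  qed
  then show ?thesis
    by (simp add: inner_matrix_eq_trace trace_J_conj)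
qed

lemma inner_J_conj_bound: "\<bar>h \<bullet> J_conj h\<bar> \<le> h \<bullet> h"
proof -
  have "norm (J_conj h) = norm h"
    by (simp add: norm_eq_sqrt_inner inner_J_conj_J_conj)
  then show ?thesis
    using Cauchy_Schwarz_ineq2[of h "J_conj h"] by (simp add: power2_norm_eq_inner[symmetric] power2_eq_square)
qed

lemma inner_R_bar: "R_bar R h \<bullet> h' =
    (\<Sum>i\<in>UNIV. \<Sum>j\<in>UNIV. \<Sum>k\<in>UNIV. \<Sum>l\<in>UNIV. R i k l j * (h' $ i $ j * h $ k $ l))"
  by (simp add: R_bar_def inner_vec_def sum_distrib_left mult_ac)

lemma R_bar_symmetric: "R_bar R h \<bullet> h' = h \<bullet> R_bar R h'"
proof -
  have "R_bar R h' \<bullet> h = (\<Sum>k\<in>UNIV. \<Sum>l\<in>UNIV. \<Sum>i\<in>UNIV. \<Sum>j\<in>UNIV. R i k l j * (h $ i $ j * h' $ k $ l))"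
    unfolding inner_R_bar by (rule sum_swap_pairs)
  also have "\<dots> = R_bar R h \<bullet> h'"
    unfolding inner_R_bar
  proof (intro sum.cong refl)
    fix i j k l
    have "R k i j l = R i k l j"
      using antisym_left[of k i j l] antisym_right[of i k j l] by simp
    then show "R k i j l * (h $ k $ l * h' $ i $ j) = R i k l j * (h' $ i $ j * h $ k $ l)"
      by simp
  qed
  finally show ?thesis by (simp add: inner_commute)
qed

context
  fixes B :: "(real^'n^'n) set"
  assumes B: "S20_basis B"
begin

text \<open>This trace and the next one are linear functionals of \<open>R\<close> that are invariant under the unitary group, hence
  multiples of the scalar curvature.\<close>

lemma trace_R_bar:
  "(\<Sum>b\<in>B. R_bar R b \<bullet> b) = scalar_curv / 2 + scalar_curv / real CARD('n)"
  unfolding inner_R_bar S20_basis.quadratic_form_trace[OF B]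
  by (simp add: diag_zero scalar_curv_neg) (simp add: scalar_curv_def)

lemma trace_R_bar_J_conj:
  "(\<Sum>b\<in>B. R_bar R b \<bullet> J_conj b) = - 3 / 2 * scalar_curv + scalar_curv / real CARD('n)"
proof -
  define c where "c p q k l = (\<Sum>i\<in>UNIV. \<Sum>j\<in>UNIV. R i k l j * M $ p $ i * M $ q $ j)" for p q k l
  have "R_bar R b \<bullet> J_conj b = (\<Sum>p\<in>UNIV. \<Sum>q\<in>UNIV. \<Sum>k\<in>UNIV. \<Sum>l\<in>UNIV. c p q k l * (b $ p $ q * b $ k $ l))" for b
  proof -
    let ?X = "\<lambda>i j. \<Sum>k\<in>UNIV. \<Sum>l\<in>UNIV. R i k l j * b $ k $ l"
    have "R_bar R b \<bullet> J_conj b = (\<Sum>i\<in>UNIV. \<Sum>j\<in>UNIV. ?X i j * (\<Sum>p\<in>UNIV. \<Sum>q\<in>UNIV. M $ p $ i * M $ q $ j * b $ p $ q))"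
      unfolding inner_vec_def J_conj_entry by (simp add: R_bar_def)
    also have "\<dots> = (\<Sum>i\<in>UNIV. \<Sum>j\<in>UNIV. \<Sum>p\<in>UNIV. \<Sum>q\<in>UNIV. ?X i j * (M $ p $ i * M $ q $ j * b $ p $ q))"
      by (simp only: sum_distrib_left)
    also have "\<dots> = (\<Sum>p\<in>UNIV. \<Sum>q\<in>UNIV. \<Sum>i\<in>UNIV. \<Sum>j\<in>UNIV. ?X i j * (M $ p $ i * M $ q $ j * b $ p $ q))"
      by (rule sum_swap_pairs)
    also have "\<dots> = (\<Sum>p\<in>UNIV. \<Sum>q\<in>UNIV. \<Sum>i\<in>UNIV. \<Sum>j\<in>UNIV. \<Sum>k\<in>UNIV. \<Sum>l\<in>UNIV.
        R i k l j * M $ p $ i * M $ q $ j * (b $ p $ q * b $ k $ l))"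
      by (simp add: sum_distrib_left sum_distrib_right mult_ac)
    also have "\<dots> = (\<Sum>p\<in>UNIV. \<Sum>q\<in>UNIV. \<Sum>k\<in>UNIV. \<Sum>l\<in>UNIV. \<Sum>i\<in>UNIV. \<Sum>j\<in>UNIV.
        R i k l j * M $ p $ i * M $ q $ j * (b $ p $ q * b $ k $ l))"
      by (rule sum.cong[OF refl], rule sum.cong[OF refl], rule sum_swap_pairs)
    finally show ?thesis
      by (simp only: c_def sum_distrib_right)
  qed
  moreover have "(\<Sum>p\<in>UNIV. \<Sum>q\<in>UNIV. c p q p q) = - 2 * scalar_curv"
  proof -
    have "(\<Sum>p\<in>UNIV. \<Sum>q\<in>UNIV. c p q p q)
        = (\<Sum>p\<in>UNIV. \<Sum>i\<in>UNIV. \<Sum>q\<in>UNIV. \<Sum>j\<in>UNIV. R i p q j * M $ p $ i * M $ q $ j)"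
      unfolding c_def by (rule sum.cong[OF refl], rule sum.swap)
    also have "\<dots> = (\<Sum>i\<in>UNIV. \<Sum>p\<in>UNIV. \<Sum>q\<in>UNIV. \<Sum>j\<in>UNIV. R i p q j * M $ p $ i * M $ q $ j)"
      by (rule sum.swap)
    finally show ?thesis by (simp only: J_contraction')
  qed
  moreover have "(\<Sum>p\<in>UNIV. \<Sum>q\<in>UNIV. c p q q p) = - scalar_curv"
  proof -
    have "(\<Sum>p\<in>UNIV. \<Sum>q\<in>UNIV. c p q q p)
        = (\<Sum>q\<in>UNIV. \<Sum>p\<in>UNIV. \<Sum>i\<in>UNIV. \<Sum>j\<in>UNIV. R i q p j * M $ p $ i * M $ q $ j)"
      unfolding c_def by (rule sum.swap)
    also have "\<dots> = (\<Sum>q\<in>UNIV. \<Sum>i\<in>UNIV. \<Sum>p\<in>UNIV. \<Sum>j\<in>UNIV. R i q p j * M $ p $ i * M $ q $ j)"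
      by (rule sum.cong[OF refl], rule sum.swap)
    also have "\<dots> = (\<Sum>i\<in>UNIV. \<Sum>q\<in>UNIV. \<Sum>p\<in>UNIV. \<Sum>j\<in>UNIV. R i q p j * M $ p $ i * M $ q $ j)"
      by (rule sum.swap)
    finally show ?thesis by (simp only: J_contraction)
  qed
  moreover have "(\<Sum>p\<in>UNIV. \<Sum>k\<in>UNIV. c p p k k) = - scalar_curv"
  proof -
    have \<delta>: "(\<Sum>p\<in>UNIV. M $ p $ i * M $ p $ j) = (if i = j then 1 else 0)" for i j
      using arg_cong[OF M_orth, of "\<lambda>P. P $ i $ j"] by (simp add: matrix_matrix_mult_def transpose_def mat_def)
    have "(\<Sum>p\<in>UNIV. \<Sum>k\<in>UNIV. c p p k k)
        = (\<Sum>i\<in>UNIV. \<Sum>j\<in>UNIV. \<Sum>p\<in>UNIV. \<Sum>k\<in>UNIV. R i k k j * M $ p $ i * M $ p $ j)"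
      unfolding c_def by (rule sum_swap_pairs)
    also have "\<dots> = (\<Sum>i\<in>UNIV. \<Sum>j\<in>UNIV. (\<Sum>p\<in>UNIV. M $ p $ i * M $ p $ j) * (\<Sum>k\<in>UNIV. R i k k j))"
      by (simp only: sum_product) (simp only: mult_ac)
    also have "\<dots> = (\<Sum>i\<in>UNIV. \<Sum>k\<in>UNIV. R i k k i)"
      unfolding \<delta> by (simp add: if_distrib[of "\<lambda>t. t * _"] cong: if_cong)
    finally show ?thesis by (simp only: scalar_curv_neg)
  qed
  ultimately show ?thesis
    by (simp add: S20_basis.quadratic_form_trace[OF B])
qed

lemma trace_identity:
  "(\<Sum>b\<in>B. b \<bullet> b) = (real CARD('n) ^ 2 + real CARD('n)) / 2 - 1"
proof -
  have "(\<Sum>b\<in>B. b \<bullet> b) = (\<Sum>i\<in>UNIV. \<Sum>j\<in>UNIV. \<Sum>b\<in>B. b $ i $ j * b $ i $ j)"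
    by (simp add: inner_vec_def sum.swap[of _ UNIV B])
  also have "\<dots> = (\<Sum>i\<in>(UNIV :: 'n set). \<Sum>j\<in>UNIV. 1/2 + (if i = j then 1 / 2 - 1 / real CARD('n) else 0))"
    unfolding S20_basis.entry_products_sum[OF B]
    by (intro sum.cong refl) auto
  also have "\<dots> = (real CARD('n) ^ 2 + real CARD('n)) / 2 - 1"
    by (simp add: sum.distrib) (simp add: power2_eq_square field_simps)
  finally show ?thesis .
qed

lemma trace_J_conj_operator:
  "(\<Sum>b\<in>B. b \<bullet> J_conj b) = - real CARD('n) / 2 - 1"
proof -
  have "b \<bullet> J_conj b = (\<Sum>i\<in>UNIV. \<Sum>j\<in>UNIV. \<Sum>p\<in>UNIV. \<Sum>q\<in>UNIV. M $ p $ i * M $ q $ j * (b $ i $ j * b $ p $ q))" for b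
    unfolding inner_vec_def J_conj_entry by (simp add: sum_distrib_left mult_ac)
  moreover have "M $ i $ i = 0" for i
    using M_skew'[of i i] by simp
  moreover have sq: "(\<Sum>i\<in>UNIV. \<Sum>p\<in>UNIV. M $ p $ i * M $ p $ i) = real CARD('n)"
    using arg_cong[OF M_orth, of trace] by (simp add: matrix_matrix_mult_def transpose_def trace_def mat_def)
  moreover have "(\<Sum>i\<in>UNIV. \<Sum>j\<in>UNIV. M $ j $ i * M $ i $ j) = - real CARD('n)"
  proof -
    have "(\<Sum>i\<in>UNIV. \<Sum>j\<in>UNIV. M $ j $ i * M $ i $ j) = (\<Sum>i\<in>UNIV. \<Sum>j\<in>UNIV. - (M $ j $ i * M $ j $ i))"
    proof (intro sum.cong refl)
      fix i j show "M $ j $ i * M $ i $ j = - (M $ j $ i * M $ j $ i)"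
        unfolding M_skew'[of i j] by simp
    qed
    then show ?thesis by (simp add: sum_negf sq)
  qed
  ultimately show ?thesis
    by (simp add: S20_basis.quadratic_form_trace[OF B])
qed

end

end


section \<open>Weighted eigenvalue sums\<close>

text \<open>Let \<open>\<mu>\<close> be the first eigenvalue that \<open>weighted_sum ls k\<close> does not count in full. Among all weights
  in \<open>[0, 1]\<close>, the truncation at \<open>\<mu>\<close> minimizes the weighted sum of the shifted eigenvalues
  \<open>ls ! i - \<mu>\<close>; comparing it with \<open>w\<close> gives \<open>weighted_sum ls k \<le> \<mu> (k - \<Sum>w)\<close>, and hence \<open>\<mu> \<le> 0\<close>. So all
  fully counted eigenvalues are nonpositive with nonnegative sum, the smallest one is \<open>0\<close>, and
  a sum of nonnegative numbers with positive weights vanishes only if every term does.\<close>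

lemma weighted_sum_nonneg_imp_zero:
  assumes "sorted ls" "1 \<le> k" "weighted_sum ls k \<ge> 0"
    and w: "\<And>i. i < length ls \<Longrightarrow> 0 < w i \<and> w i \<le> 1"
    and total: "k < (\<Sum>i<length ls. w i)"
    and balanced: "(\<Sum>i<length ls. ls ! i * w i) = 0"
    and i: "i < length ls"
  shows "ls ! i = 0"
proof -
  define p where "p = nat \<lfloor>k\<rfloor>"
  \<comment> \<open>The list is indexed from 0, so this is the eigenvalue with number \<open>\<lfloor>k\<rfloor> + 1\<close>.\<close>
  define \<mu> where "\<mu> = ls ! p"
  have p: "1 \<le> p" "real p \<le> k" "k < real p + 1"
    using \<open>1 \<le> k\<close> by (auto simp: p_def le_nat_iff)
  have "(\<Sum>i<length ls. w i) \<le> (\<Sum>i<length ls. 1)"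
    using w by (intro sum_mono) auto
  then have "p < length ls"
    using total p by simp
  have mono: "ls ! i \<le> ls ! j" if "i \<le> j" "j < length ls" for i j
    using that \<open>sorted ls\<close> sorted_nth_mono by blast
  \<comment> \<open>For integral \<open>k\<close> the last coefficient is 0, so one formula covers both cases.\<close>
  have frac: "weighted_sum ls k = (\<Sum>i<p. ls ! i) + (k - real p) * \<mu>"
  proof (cases "k \<in> \<int>")
    case True
    then have "real p = k"
      using \<open>1 \<le> k\<close> by (auto simp: p_def elim!: Ints_cases)
    then show ?thesis using True by (simp add: weighted_sum_def p_def)
  next
    case False
    then show ?thesis
      using \<open>1 \<le> k\<close> by (simp add: weighted_sum_def p_def \<mu>_def)
  qed
  have "(\<Sum>i<p. ls ! i - \<mu>) \<le> (\<Sum>i<p. w i * (ls ! i - \<mu>))"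
  proof (rule sum_mono)
    fix i assume "i \<in> {..<p}"
    then have "ls ! i \<le> \<mu>" "w i \<le> 1"
      using mono[of i p] w[of i] \<open>p < length ls\<close> by (auto simp: \<mu>_def)
    then have "0 \<le> (1 - w i) * (\<mu> - ls ! i)" by simp
    then show "ls ! i - \<mu> \<le> w i * (ls ! i - \<mu>)" by (simp add: algebra_simps)
  qed
  also have "\<dots> \<le> (\<Sum>i<length ls. w i * (ls ! i - \<mu>))"
  proof (rule sum_mono2)
    fix i assume "i \<in> {..<length ls} - {..<p}"
    then show "0 \<le> w i * (ls ! i - \<mu>)"
      using mono[of p i] w[of i] by (auto simp: \<mu>_def)
  qed (use \<open>p < length ls\<close> in auto)
  also have "\<dots> = - \<mu> * (\<Sum>i<length ls. w i)"
    using balanced by (simp add: right_diff_distrib sum_subtractf mult_ac sum_distrib_left sum_negf)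
  finally have "weighted_sum ls k \<le> \<mu> * (k - (\<Sum>i<length ls. w i))"
    unfolding frac by (simp add: sum_subtractf algebra_simps)
  then have "0 \<le> \<mu> * (k - (\<Sum>i<length ls. w i))"
    using assms(3) by linarith
  then have \<mu>: "\<mu> \<le> 0"
    using total by (simp add: zero_le_mult_iff)
  have nonpos: "ls ! i \<le> 0" if "i < p" for i
    using mono[of i p] that \<open>p < length ls\<close> \<mu> by (simp add: \<mu>_def)
  have "(k - real p) * \<mu> \<le> 0"
    using p \<mu> by (simp add: mult_nonneg_nonpos)
  then have "0 \<le> (\<Sum>i<p. ls ! i)"
    using assms(3) frac by linarith
  also have "\<dots> = ls ! 0 + (\<Sum>i\<in>{..<p} - {0}. ls ! i)"
    using p by (subst sum.remove[of _ 0]) auto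
  also have "\<dots> \<le> ls ! 0 + 0"
    using nonpos by (intro add_left_mono sum_nonpos) auto
  finally have nonneg: "0 \<le> ls ! i" if "i < length ls" for i
    using mono[of 0 i] that by simp
  have "\<forall>i\<in>{..<length ls}. ls ! i * w i = 0"
    using balanced nonneg w by (subst (asm) sum_nonneg_eq_0_iff) (auto simp: less_imp_le)
  then show ?thesis
    using i w[OF i] by auto
qed

text \<open>
  Symmetry makes distinct eigenspaces orthogonal, and the multiplicities in the list add up to the
  dimension of \<open>V\<close>, so orthonormal bases of the eigenspaces together span \<open>V\<close>. Sorting this basis
  by eigenvalue aligns it with \<open>ls\<close>.
\<close>

lemma eigenvalue_list_orthonormal_basis:
  fixes V :: "'v::euclidean_space set"
  assumes "eigenvalue_list V T ls" "subspace V" "linear T"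
    and sym: "\<And>h h'. h \<in> V \<Longrightarrow> h' \<in> V \<Longrightarrow> T h \<bullet> h' = h \<bullet> T h'"
  obtains bs where "length bs = length ls" "distinct bs" "span (set bs) = V"
    "\<And>b b'. b \<in> set bs \<Longrightarrow> b' \<in> set bs \<Longrightarrow> b \<bullet> b' = (if b = b' then 1 else 0)"
    "\<And>i. i < length ls \<Longrightarrow> T (bs ! i) = ls ! i *\<^sub>R bs ! i"
proof -
  \<comment> \<open>The eigenspaces of \<open>T\<close>; the function \<open>\<Lambda>\<close> below recovers the eigenvalue of a basis vector.\<close>
  define E where "E \<mu> = {h \<in> V. T h = \<mu> *\<^sub>R h}" for \<mu>
  have ls: "sorted ls" "length ls = dim V" "\<And>\<mu>. count (mset ls) \<mu> = dim (E \<mu>)"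
    using assms(1) by (auto simp: eigenvalue_list_def E_def)
  have "subspace (E \<mu>)" for \<mu>
    using assms(2,3) by (auto simp: subspace_def E_def linear_add linear_scale linear_0 scaleR_add_right)
  then have "\<exists>B. B \<subseteq> E \<mu> \<and> pairwise orthogonal B \<and> (\<forall>x\<in>B. norm x = 1) \<and> independent B \<and> card B = dim (E \<mu>)" for \<mu>
    by (metis orthonormal_basis_subspace)
  then obtain B where B: "\<And>\<mu>. B \<mu> \<subseteq> E \<mu>" "\<And>\<mu>. pairwise orthogonal (B \<mu>)" "\<And>\<mu> x. x \<in> B \<mu> \<Longrightarrow> norm x = 1"
      "\<And>\<mu>. independent (B \<mu>)" "\<And>\<mu>. card (B \<mu>) = dim (E \<mu>)"
    by metis
  have fin: "finite (B \<mu>)" for \<mu>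
    using B(4) independent_imp_finite by blast
  define U where "U = (\<Union>\<mu>\<in>set ls. B \<mu>)"
  define \<Lambda> where "\<Lambda> b = (THE \<mu>. T b = \<mu> *\<^sub>R b)" for b
  have \<Lambda>: "\<Lambda> b = \<mu>" if "b \<in> B \<mu>" for b \<mu>
  proof -
    have "b \<noteq> 0" "T b = \<mu> *\<^sub>R b"
      using B(3)[OF that] subsetD[OF B(1) that] by (auto simp: E_def)
    then show ?thesis
      unfolding \<Lambda>_def by (intro the_equality) auto
  qed
  have "finite U"
    by (auto simp: U_def fin)
  have orth: "b \<bullet> b' = (if b = b' then 1 else 0)" if b: "b \<in> U" "b' \<in> U" for b b'
  proof -
    obtain \<mu> \<nu> where m: "b \<in> B \<mu>" "b' \<in> B \<nu>"
      using b by (auto simp: U_def)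
    show ?thesis
    proof (cases "\<mu> = \<nu>")
      case True
      then show ?thesis
        using m B(2)[of \<mu>] B(3) by (auto simp: pairwise_def orthogonal_def norm_eq_1)
    next
      case False
      have "b \<in> V" "b' \<in> V" "T b = \<mu> *\<^sub>R b" "T b' = \<nu> *\<^sub>R b'"
        using m B(1) by (auto simp: E_def)
      then have "\<mu> * (b \<bullet> b') = \<nu> * (b \<bullet> b')"
        using sym[of b b'] by simp
      moreover have "b \<noteq> b'"
        using \<Lambda>[OF m(1)] \<Lambda>[OF m(2)] False by auto
      ultimately show ?thesis using False by simp
    qed
  qed
  have level: "{b \<in> U. \<Lambda> b = \<mu>} = B \<mu>" for \<mu>
  proof -
    have "B \<mu> = {}" if "\<mu> \<notin> set ls"
    proof -
      have "count (mset ls) \<mu> = 0"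
        using that by (simp add: count_eq_zero_iff)
      then show ?thesis
        using ls(3)[of \<mu>] B(5)[of \<mu>] fin[of \<mu>] by (metis card_0_eq)
    qed
    then show ?thesis
      by (auto simp: U_def \<Lambda>)
  qed
  have image: "image_mset \<Lambda> (mset_set U) = mset ls"
  proof (rule multiset_eqI)
    fix \<mu>
    have "count (image_mset \<Lambda> (mset_set U)) \<mu> = card {b \<in> U. \<Lambda> b = \<mu>}"
      using \<open>finite U\<close> by (simp add: count_image_mset' eq_commute[of \<mu>])
    then show "count (image_mset \<Lambda> (mset_set U)) \<mu> = count (mset ls) \<mu>"
      by (simp add: level ls(3) B(5))
  qed
  have card_U: "card U = dim V"
    using arg_cong[OF image, of size] ls(2) by simp
  obtain cs where cs: "set cs = U" "distinct cs"
    using \<open>finite U\<close> finite_distinct_list by blast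
  define bs where "bs = sort_key \<Lambda> cs"
  have bs: "set bs = U" "distinct bs"
    by (simp_all add: bs_def cs)
  have "mset (map \<Lambda> bs) = mset ls"
    using image cs by (simp add: bs_def mset_set_set[symmetric])
  moreover have "sorted (map \<Lambda> bs)"
    by (simp add: bs_def)
  ultimately have map: "map \<Lambda> bs = ls"
    using ls(1) by (metis properties_for_sort)
  have sub: "U \<subseteq> V"
    using B(1) by (auto simp: U_def E_def)
  have "independent U"
    using orth orth[of 0 0] by (intro pairwise_orthogonal_independent) (auto simp: pairwise_def orthogonal_def)
  then have "span U = V"
    using sub card_U assms(2) card_ge_dim_independent[of U V] span_minimal[of U V] by auto
  show ?thesis
  proof
    show "length bs = length ls" by (simp flip: map)
    show "T (bs ! i) = ls ! i *\<^sub>R bs ! i" if "i < length ls" for i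
    proof -
      have "i < length bs" using that by (simp flip: map)
      then have "bs ! i \<in> U" "ls ! i = \<Lambda> (bs ! i)"
        using bs(1) nth_mem by (auto simp flip: map)
      then show ?thesis
        using B(1) \<Lambda> by (auto simp: U_def E_def)
    qed
  qed (use bs orth \<open>span U = V\<close> in auto)
qed


section \<open>The pointwise vanishing theorem\<close>

lemma linear_curv_op2: "linear (curv_op2 R)"
proof -
  have "linear (R_bar R)"
    by (rule linearI) (simp_all add: R_bar_def vec_eq_iff distrib_left sum.distrib sum_distrib_left mult_ac)
  moreover have "linear pr_S20"
    by (rule linearI)
       (simp_all add: pr_S20_def trace_def sum.distrib add_divide_distrib sum_distrib_left[symmetric] algebra_simps)
  ultimately show ?thesis
    unfolding curv_op2_def by (metis linear_compose)
qed

lemma curv_op2_uminus: "curv_op2 (\<lambda>i j k l. - R i j k l) h = - curv_op2 R h"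
proof -
  have "R_bar (\<lambda>i j k l. - R i j k l) h = - R_bar R h"
    by (simp add: R_bar_def vec_eq_iff sum_negf)
  moreover have "pr_S20 (- h) = - pr_S20 h" for h :: "real^'n^'n"
    by (simp add: pr_S20_def trace_def sum_negf)
  ultimately show ?thesis by (simp add: curv_op2_def)
qed

context kaehler_tensor
begin

lemma inner_curv_op2:
  assumes "trace h' = 0"
  shows "curv_op2 R h \<bullet> h' = R_bar R h \<bullet> h'"
  using inner_pr_S20[OF assms] by (simp add: curv_op2_def inner_commute)

text \<open>The operator \<open>\<alpha> h + \<beta> J_conj h\<close> is \<open>1\<close> on \<open>J\<close>-invariant and \<open>(m - 1) / (2 m)\<close> on
  \<open>J\<close>-anti-invariant tensors. These are the weights for which its product with \<open>\<R>\<close> is trace-free for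
  the curvature of complex projective space, and hence for every Kaehler curvature tensor. Its
  diagonal entries in an eigenbasis of \<open>\<R>\<close> serve as weights in
  \<open>weighted_sum_nonneg_imp_zero\<close>; their total, the trace of the operator on \<open>S20\<close>, is \<open>3/2 (m\<^sup>2 - 1)\<close>.\<close>

theorem eigenvalue_sum_nonneg_imp_zero:
  assumes card: "CARD('n) = 2 * m" and k: "1 \<le> k" "k < 3 / 2 * (real m ^ 2 - 1)"
    and nonneg: "k_nonneg_op S20 (curv_op2 R) k"
  shows "R i j k' l = 0"
proof -
  obtain ls where ls: "eigenvalue_list S20 (curv_op2 R) ls" "weighted_sum ls k \<ge> 0"
    using nonneg by (auto simp: k_nonneg_op_def)
  have "curv_op2 R h \<bullet> h' = h \<bullet> curv_op2 R h'" if "h \<in> S20" "h' \<in> S20" for h h'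
    using that inner_curv_op2[of h' h] inner_curv_op2[of h h'] R_bar_symmetric[of h h']
    by (simp add: S20_def inner_commute)
  from eigenvalue_list_orthonormal_basis[OF ls(1) subspace_S20 linear_curv_op2 this]
  obtain bs where bs: "length bs = length ls" "distinct bs" "span (set bs) = S20"
    and orth: "\<And>b b'. b \<in> set bs \<Longrightarrow> b' \<in> set bs \<Longrightarrow> b \<bullet> b' = (if b = b' then 1 else 0)"
    and eigen: "\<And>i. i < length ls \<Longrightarrow> curv_op2 R (bs ! i) = ls ! i *\<^sub>R bs ! i"
    by blast
  have B: "S20_basis (set bs)"
    using bs orth by unfold_locales auto
  have reindex: "(\<Sum>i<length ls. f (bs ! i)) = (\<Sum>b\<in>set bs. f b)" for f :: "real^'n^'n \<Rightarrow> real"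
    using sum.reindex_bij_betw[OF bij_betw_nth[OF bs(2) refl refl]] by (simp add: bs(1))
  have "1 < real m ^ 2"
    using k by simp
  then have "2 \<le> m"
    by (cases "m < 2") (auto simp: less_2_cases_iff)
  define \<alpha> \<beta> where "\<alpha> = (3 * real m - 1) / (4 * real m)" and "\<beta> = (real m + 1) / (4 * real m)"
  have \<alpha>\<beta>: "\<alpha> + \<beta> = 1" "\<beta> < \<alpha>" "0 < \<beta>" "\<alpha> - 3 * \<beta> = - 1 / real m"
    using \<open>2 \<le> m\<close> by (auto simp: \<alpha>_def \<beta>_def field_simps)
  define w where "w b = \<alpha> * (b \<bullet> b) + \<beta> * (b \<bullet> J_conj b)" for b
  have w: "0 < w b \<and> w b \<le> 1" if "b \<in> set bs" for b
  proof -
    have "b \<bullet> b = 1" "\<bar>b \<bullet> J_conj b\<bar> \<le> 1"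
      using orth[OF that that] inner_J_conj_bound[of b] by auto
    then have "\<bar>\<beta> * (b \<bullet> J_conj b)\<bar> \<le> \<beta>"
      using \<alpha>\<beta> by (simp add: abs_mult mult_left_le)
    then show ?thesis
      using \<alpha>\<beta> \<open>b \<bullet> b = 1\<close> by (auto simp: w_def)
  qed
  have "(\<Sum>i<length ls. w (bs ! i)) = \<alpha> * (\<Sum>b\<in>set bs. b \<bullet> b) + \<beta> * (\<Sum>b\<in>set bs. b \<bullet> J_conj b)"
    unfolding reindex by (simp add: w_def sum.distrib sum_distrib_left)
  also have "\<dots> = 3 / 2 * (real m ^ 2 - 1)"
    unfolding trace_identity[OF B] trace_J_conj_operator[OF B] card \<alpha>_def \<beta>_def
    using \<open>2 \<le> m\<close> by (simp add: field_simps power2_eq_square)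
  finally have total: "k < (\<Sum>i<length ls. w (bs ! i))"
    using k by simp
  have "(\<Sum>i<length ls. ls ! i * w (bs ! i))
      = (\<Sum>i<length ls. \<alpha> * (R_bar R (bs ! i) \<bullet> bs ! i) + \<beta> * (R_bar R (bs ! i) \<bullet> J_conj (bs ! i)))"
  proof (rule sum.cong[OF refl])
    fix i assume "i \<in> {..<length ls}"
    then have i: "i < length ls" by simp
    then have tr: "trace (bs ! i) = 0"
      using S20_basis.B_S20[OF B, of "bs ! i"] bs(1) by (simp add: S20_def)
    have "ls ! i * w (bs ! i) = \<alpha> * (curv_op2 R (bs ! i) \<bullet> bs ! i) + \<beta> * (curv_op2 R (bs ! i) \<bullet> J_conj (bs ! i))"
      by (simp add: eigen[OF i] w_def algebra_simps)
    also have "\<dots> = \<alpha> * (R_bar R (bs ! i) \<bullet> bs ! i) + \<beta> * (R_bar R (bs ! i) \<bullet> J_conj (bs ! i))"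
      using tr by (simp add: inner_curv_op2 trace_J_conj)
    finally show "ls ! i * w (bs ! i) = \<dots>" .
  qed
  also have "\<dots> = \<alpha> * (\<Sum>b\<in>set bs. R_bar R b \<bullet> b) + \<beta> * (\<Sum>b\<in>set bs. R_bar R b \<bullet> J_conj b)"
    unfolding reindex[of "\<lambda>b. \<alpha> * (R_bar R b \<bullet> b) + \<beta> * (R_bar R b \<bullet> J_conj b)"]
    by (simp add: sum.distrib sum_distrib_left)
  also have "\<dots> = scalar_curv * ((\<alpha> - 3 * \<beta>) / 2 + (\<alpha> + \<beta>) / (2 * real m))"
    unfolding trace_R_bar[OF B] trace_R_bar_J_conj[OF B] card by (simp add: algebra_simps add_divide_distrib diff_divide_distrib)
  also have "\<dots> = 0"
    unfolding \<alpha>\<beta> by simp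
  finally have balanced: "(\<Sum>i<length ls. ls ! i * w (bs ! i)) = 0" .
  have "sorted ls"
    using ls(1) by (simp add: eigenvalue_list_def)
  have "ls ! i = 0" if "i < length ls" for i
    by (rule weighted_sum_nonneg_imp_zero[OF \<open>sorted ls\<close> k(1) ls(2) _ total balanced that])
       (use w bs(1) in auto)
  then have "curv_op2 R b = 0" if "b \<in> set bs" for b
    using that eigen bs(1) by (auto simp: in_set_conv_nth)
  then have "curv_op2 R h = 0" if "h \<in> S20" for h
    using linear_eq_0_on_span[OF linear_curv_op2] that bs(3) by blast
  then show ?thesis
    by (rule curv_op2_zero_imp_zero)
qed

end

text \<open>The bound \<open>1 \<le> k\<close> excludes \<open>m = 1\<close>, where both constants are \<open>0\<close>. For even \<open>m\<close> the comparison
  amounts to \<open>(m - 2) (m + 1) \<ge> 0\<close>, with equality for \<open>m = 2\<close>.\<close>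

lemma kaehler_const_le:
  assumes "1 \<le> k" "k < kaehler_const m" "0 < m"
  shows "k < 3 / 2 * (real m ^ 2 - 1)"
proof -
  have "m \<noteq> 1"
    using assms by (auto simp: kaehler_const_def)
  then have m: "2 \<le> m" using assms(3) by simp
  define x where "x = real m"
  have x: "2 \<le> x" using m by (simp add: x_def)
  have "kaehler_const m \<le> 3 / 2 * (x ^ 2 - 1)"
  proof (cases "even m")
    case True
    have "0 \<le> (x - 2) * (x + 1) * (x + 1)"
      using x by simp
    then show ?thesis
      using True x by (simp add: kaehler_const_def x_def[symmetric] field_simps power2_eq_square)
  next
    case False
    have "3 * x * (((x + 1) * (x\<^sup>2 - 1)) / ((x + 2) * (x\<^sup>2 + 1)))
        = 3 * (x\<^sup>2 - 1) * ((x * (x + 1)) / ((x + 2) * (x\<^sup>2 + 1)))"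
      by (simp add: mult_ac)
    also have "\<dots> \<le> 3 * (x\<^sup>2 - 1) * (1 / 2)"
    proof (rule mult_left_mono)
      have "2 * (x * (x + 1)) \<le> (x + 2) * (x\<^sup>2 + 1)"
      proof -
        have "(x + 2) * (x\<^sup>2 + 1) - 2 * (x * (x + 1)) = x * (x * x - 1) + 2"
          by (simp add: algebra_simps power2_eq_square)
        moreover have "1 \<le> x * x" using x mult_mono[of 1 x 1 x] by simp
        ultimately show ?thesis using x by (smt (verit) mult_nonneg_nonneg)
      qed
      moreover have "0 < (x + 2) * (x\<^sup>2 + 1)"
        using x by (intro mult_pos_pos add_nonneg_pos) auto
      ultimately show "(x * (x + 1)) / ((x + 2) * (x\<^sup>2 + 1)) \<le> 1 / 2"
        by (simp add: divide_le_eq)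
      show "0 \<le> 3 * (x\<^sup>2 - 1)"
        using x by simp
    qed
    finally show ?thesis
      using False by (simp add: kaehler_const_def x_def[symmetric])
  qed
  then show ?thesis using assms(2) by (simp add: x_def)
qed


section \<open>From charts to frames\<close>

text \<open>The matrix \<open>F\<close> with columns \<open>e i\<close> has the left inverse \<open>F\<^sup>T P\<close>, which is therefore also a right
  inverse.\<close>

lemma orthonormal_frame_expansion:
  fixes e :: "'n::finite \<Rightarrow> real^'n"
  assumes "orthonormal_frame P e"
  shows "v = (\<Sum>i\<in>UNIV. (e i \<bullet> (P *v v)) *\<^sub>R e i)"
proof -
  define F where "F = (\<chi> a i. e i $ a)"
  have "transpose F ** (P ** F) = mat 1"
  proof -
    have "(transpose F ** (P ** F)) $ i $ j = e i \<bullet> (P *v e j)" for i j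
      by (simp add: F_def matrix_matrix_mult_def matrix_vector_mult_def transpose_def inner_vec_def)
    then show ?thesis
      using assms by (simp add: vec_eq_iff orthonormal_frame_def mat_def)
  qed
  then have "F ** (transpose F ** P) = mat 1"
    using matrix_left_right_inverse by (metis matrix_mul_assoc)
  then have "v = F *v (transpose F *v (P *v v))"
    by (metis matrix_vector_mul_assoc matrix_vector_mul_lid)
  also have "\<dots> = (\<Sum>i\<in>UNIV. (transpose F *v (P *v v)) $ i *\<^sub>R e i)"
  proof -
    have "F *v y = (\<Sum>i\<in>UNIV. y $ i *\<^sub>R e i)" for y
      by (simp add: vec_eq_iff F_def matrix_vector_mult_def mult.commute)
    then show ?thesis .
  qed
  also have "\<dots> = (\<Sum>i\<in>UNIV. (e i \<bullet> (P *v v)) *\<^sub>R e i)"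
  proof -
    have "(transpose F *v u) $ i = e i \<bullet> u" for u i
      by (simp add: F_def matrix_vector_mult_def transpose_def inner_vec_def del: transpose_matrix_vector)
    then show ?thesis by (simp only:)
  qed
  finally show ?thesis .
qed

lemma linear_frame_zero:
  assumes "orthonormal_frame P e" "linear (f :: real^'n \<Rightarrow> real)" "\<And>i. f (e i) = 0"
  shows "f v = 0"
  by (subst orthonormal_frame_expansion[OF assms(1), of v])
     (simp add: linear_sum[OF assms(2)] linear_scale[OF assms(2)] assms(3))

context kaehler_chart
begin

lemma Rm_frame_zero:
  assumes "orthonormal_frame P e" "\<And>i j k l. Rm G x (e i) (e j) (e k) (e l) = 0"
  shows "Rm G x u v w z = 0"
proof -
  note zero = linear_frame_zero[OF assms(1)]
  have "Rm G x (e i) (e j) (e k) z = 0" for i j k z by (rule zero) (auto intro: linear_Rm assms(2))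
  then have "Rm G x (e i) (e j) w z = 0" for i j w z by (rule zero[OF linear_Rm(3)])
  then have "Rm G x (e i) v w z = 0" for i v w z by (rule zero[OF linear_Rm(2)])
  then show ?thesis by (rule zero[OF linear_Rm(1)])
qed

lemma kaehler_tensor_frame:
  assumes x: "x \<in> S" and e: "orthonormal_frame (G x) e"
  shows "kaehler_tensor (\<lambda>i j k l. Rm G x (e i) (e j) (e k) (e l))
    (\<chi> i j. e i \<bullet> (G x *v (J x *v e j)))"
proof
  define M where "M = (\<chi> i j. e i \<bullet> (G x *v (J x *v e j)))"
  have Je: "J x *v e j = (\<Sum>i\<in>UNIV. M $ i $ j *\<^sub>R e i)" for j
    using orthonormal_frame_expansion[OF e, of "J x *v e j"] by (simp add: M_def)
  have move: "(A *v p) \<bullet> q = p \<bullet> (transpose A *v q)" for A :: "real^'n^'n" and p q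
    by (metis dot_lmul_matrix inner_commute transpose_matrix_vector)
  have swap: "p \<bullet> (G x *v q) = q \<bullet> (G x *v p)" for p q
    using move[of "G x" q p] sym_G[OF x] by (simp only: inner_commute)
  have orth: "(J x *v p) \<bullet> (G x *v (J x *v q)) = p \<bullet> (G x *v q)" for p q
    by (subst move, subst J_orth[OF x, symmetric])
       (simp only: matrix_vector_mul_assoc matrix_mul_assoc)
  show "transpose M ** M = mat 1"
  proof -
    have "(transpose M ** M) $ i $ j = (J x *v e i) \<bullet> (G x *v (J x *v e j))" for i j
      by (subst Je[of i]) (simp add: inner_sum_left M_def matrix_matrix_mult_def transpose_def)
    then show ?thesis
      using e by (simp add: orth orthonormal_frame_def vec_eq_iff mat_def)
  qed
  show "transpose M = - M"
  proof -
    have skew: "M $ j $ i = - M $ i $ j" for i j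
    proof -
      have "M $ j $ i = (J x *v e j) \<bullet> (G x *v (J x *v (J x *v e i)))"
        by (simp add: M_def orth)
      also have "J x *v (J x *v e i) = - e i"
        by (simp add: matrix_vector_mul_assoc J_square[OF x] uminus_matrix_vector_mult)
      also have "(J x *v e j) \<bullet> (G x *v (- e i)) = - (e i \<bullet> (G x *v (J x *v e j)))"
        using swap[of "J x *v e j" "e i"] by (simp add: matrix_vector_mult_uminus)
      finally show ?thesis
        by (simp add: M_def)
    qed
    show ?thesis
      unfolding vec_eq_iff transpose_def vec_lambda_beta vector_uminus_component by (intro allI skew)
  qed
  show "transpose M ** (\<chi> k l. Rm G x (e i) (e j) (e k) (e l)) ** M = (\<chi> k l. Rm G x (e i) (e j) (e k) (e l))" for i j
  proof -
    let ?N = "(\<chi> k l. Rm G x (e i) (e j) (e k) (e l)) :: real^'n^'n"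
    have "(transpose M ** ?N ** M) $ k $ l = Rm G x (e i) (e j) (e k) (e l)" for k l
    proof -
      have "(transpose M ** ?N ** M) $ k $ l
          = (\<Sum>d\<in>UNIV. M $ d $ l * (\<Sum>c\<in>UNIV. M $ c $ k * Rm G x (e i) (e j) (e c) (e d)))"
        by (simp add: matrix_matrix_mult_def transpose_def mult.commute)
      also have "\<dots> = (\<Sum>d\<in>UNIV. M $ d $ l * Rm G x (e i) (e j) (J x *v e k) (e d))"
        by (subst Je[of k]) (simp add: linear_sum[OF linear_Rm(3)] linear_scale[OF linear_Rm(3)])
      also have "\<dots> = Rm G x (e i) (e j) (J x *v e k) (J x *v e l)"
        by (subst Je[of l]) (simp add: linear_sum[OF linear_Rm(4)] linear_scale[OF linear_Rm(4)])
      finally show ?thesis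
        by (simp only: Rm_J_invariant[OF x])
    qed
    then show ?thesis
      by (simp only: vec_eq_iff vec_lambda_beta) simp
  qed
qed (use x in \<open>auto intro: Rm_antisym_left Rm_antisym_right Rm_bianchi\<close>)

end

lemma kaehler_tensor_uminus:
  assumes "kaehler_tensor R M"
  shows "kaehler_tensor (\<lambda>i j k l. - R i j k l) M"
proof -
  interpret kaehler_tensor R M by fact
  show ?thesis
  proof
    show "transpose M ** (\<chi> k l. - R i j k l) ** M = (\<chi> k l. - R i j k l)" for i j
    proof -
      have "(\<chi> k l. - R i j k l) = - (\<chi> k l. R i j k l)" by (simp add: vec_eq_iff)
      moreover have "transpose M ** (- N) ** M = - (transpose M ** N ** M)" for N
        by (simp add: vec_eq_iff matrix_matrix_mult_def sum_negf)
      ultimately show ?thesis by (simp only: J_invariant)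
    qed
    show "- R i j k l + - R j l k i + - R l i k j = 0" for i j k l
      using bianchi[of i j k l] by simp
    show "- R j i k l = - (- R i j k l)" "- R i j l k = - (- R i j k l)" for i j k l
      by (rule arg_cong[OF antisym_left], rule arg_cong[OF antisym_right])
  qed (rule M_skew M_orth)+
qed

lemma (in kaehler_manifold) kaehler_chart:
  assumes "c \<in> A"
  shows "kaehler_chart (chart_image c) (g c) (J c)"
  using assms chart_image_open metric_smooth metric_sym metric_pos J_smooth J_square J_orthogonal J_parallel
  by unfold_locales (auto simp: msmooth_def)

theorem theoremC:
  fixes X :: "'a topology" and A :: "('a, 'n::finite) chart set"
    and g J :: "('a, 'n) tensor_field" and m :: nat and C' :: real
  assumes "kaehler_manifold X A g J"
    and "connected_space X"
    and "CARD('n) = 2 * m"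
    and "C' < kaehler_const m"
    and "k_nonnegative A g C' \<or> k_nonpositive A g C'"
  shows "flat A g"
  unfolding flat_def
proof (intro ballI allI)
  fix c x u v w z
  assume c: "c \<in> A" and x: "x \<in> chart_image c"
  interpret kaehler_chart "chart_image c" "g c" "J c"
    using kaehler_manifold.kaehler_chart[OF assms(1) c] .
  have C': "1 \<le> C'"
    using assms(5) by (auto simp: k_nonnegative_def k_nonpositive_def)
  have "0 < CARD('n)" by simp
  then have "0 < m" using assms(3) by simp
  have bound: "C' < 3 / 2 * (real m ^ 2 - 1)"
    using C' assms(4) \<open>0 < m\<close> by (rule kaehler_const_le)
  have "\<exists>e. orthonormal_frame (g c x) e \<and> (\<forall>i j k l. Rm (g c) x (e i) (e j) (e k) (e l) = 0)"
    using assms(5)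
  proof
    assume "k_nonnegative A g C'"
    then obtain e where e: "orthonormal_frame (g c x) e" "k_nonneg_op S20 (curv_op2_at (g c) x e) C'"
      using c x unfolding k_nonnegative_def by blast
    show ?thesis
      using kaehler_tensor.eigenvalue_sum_nonneg_imp_zero[OF kaehler_tensor_frame[OF x e(1)] assms(3) C' bound] e
      unfolding curv_op2_at_def by blast
  next
    assume "k_nonpositive A g C'"
    then obtain e where e: "orthonormal_frame (g c x) e" "k_nonneg_op S20 (\<lambda>h. - curv_op2_at (g c) x e h) C'"
      using c x unfolding k_nonpositive_def by blast
    have "k_nonneg_op S20 (curv_op2 (\<lambda>i j k l. - Rm (g c) x (e i) (e j) (e k) (e l))) C'"
      using e(2) by (simp add: curv_op2_at_def curv_op2_uminus[abs_def])
    from kaehler_tensor.eigenvalue_sum_nonneg_imp_zero[OF kaehler_tensor_uminus[OF kaehler_tensor_frame[OF x e(1)]]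
      assms(3) C' bound this] show ?thesis
      using e(1) by auto
  qed
  then show "Rm (g c) x u v w z = 0"
    using Rm_frame_zero by blast
qed

end
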